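(* Let $(M^n,g(t))_{t\in[0,T]}$ be a solution to the Ricci flow on a closed manifold $M^n$. Let $l\ge1$, let $h(t)$ be a $C^1$ function of $t$ with $h(t)\le0$, and let $u$ be a positive solution to $$\partial_tu=\Delta u+h(t)u^{l-1}$$ on $M^n\times[0,T]$. Then $$|\nabla u(x,t)|^2\le\frac1{2t}\left(\max_{x\in M^n}u^2(x,0)-u^2(x,t)\right)\quad\text{for all }(x,t)\in M^n\times(0,T].$$
   Context: A solution to the Ricci flow is a smooth family of Riemannian metrics $g(t)$, $t\in[0,T]$, with $\frac{\partial g}{\partial t}=-2\,\mathrm{Ric}(g(t))$. $\nabla$, $\Delta$ and $|\cdot|$ are taken with respect to $g(t)$. Closed means compact without boundary. No curvature bound is assumed. *)

theory Defs
  imports "HOL-Analysis.Analysis"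
begin

section \<open>Differentiability classes\<close>

text \<open>
  Derivatives are taken within \<open>S\<close>, so that the same definition covers open sets and products
  \<open>[0,T] \<times> V\<close> with \<open>V\<close> open and \<open>T > 0\<close> (one-sided in time at the two end points).  On such sets the
  derivative within \<open>S\<close> is unique; the definition is meant for these sets only.
\<close>

primrec C_k_on :: "nat \<Rightarrow> ('v::real_normed_vector \<Rightarrow> 'w::real_normed_vector) \<Rightarrow> 'v set \<Rightarrow> bool" where
  "C_k_on 0 f S \<longleftrightarrow> continuous_on S f"
| "C_k_on (Suc k) f S \<longleftrightarrow>
     (\<forall>x\<in>S. f differentiable (at x within S)) \<and>
     (\<forall>v. C_k_on k (\<lambda>x. frechet_derivative f (at x within S) v) S)"

definition smooth_on :: "('v::real_normed_vector \<Rightarrow> 'w::real_normed_vector) \<Rightarrow> 'v set \<Rightarrow> bool" where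
  "smooth_on f S \<longleftrightarrow> (\<forall>k. C_k_on k f S)"

definition partial_deriv :: "'n \<Rightarrow> (real^'n \<Rightarrow> real) \<Rightarrow> real^'n::finite \<Rightarrow> real" where
  "partial_deriv i f y = frechet_derivative f (at y) (axis i 1)"

text \<open>
  All space derivatives of order at most \<open>k\<close> of the time-dependent function \<open>w\<close> exist and are
  jointly continuous on \<open>I \<times> V\<close>, where \<open>V\<close> is open.
\<close>

primrec C_k_in_space ::
  "nat \<Rightarrow> (real \<Rightarrow> real^'n::finite \<Rightarrow> real) \<Rightarrow> real set \<Rightarrow> (real^'n) set \<Rightarrow> bool" where
  "C_k_in_space 0 w I V \<longleftrightarrow> continuous_on (I \<times> V) (\<lambda>(t, y). w t y)"
| "C_k_in_space (Suc k) w I V \<longleftrightarrow>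
     continuous_on (I \<times> V) (\<lambda>(t, y). w t y) \<and>
     (\<forall>t\<in>I. \<forall>y\<in>V. w t differentiable (at y)) \<and>
     (\<forall>i. C_k_in_space k (\<lambda>t y. partial_deriv i (w t) y) I V)"


section \<open>Smooth manifolds\<close>

text \<open>
  A chart is a pair \<open>(U, \<phi>)\<close>; only the values of \<open>\<phi>\<close> on \<open>U\<close> matter.  The dimension is \<open>CARD('n)\<close>.
\<close>

type_synonym ('a, 'n) chart = "'a set \<times> ('a \<Rightarrow> real^'n)"

abbreviation cdom :: "('a, 'n::finite) chart \<Rightarrow> 'a set" where
  "cdom c \<equiv> fst c"

abbreviation cmap :: "('a, 'n::finite) chart \<Rightarrow> 'a \<Rightarrow> real^'n" where
  "cmap c \<equiv> snd c"

abbreviation cimage :: "('a, 'n::finite) chart \<Rightarrow> (real^'n) set" where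
  "cimage c \<equiv> cmap c ` cdom c"

definition in_coords :: "('a, 'n::finite) chart \<Rightarrow> ('a \<Rightarrow> 'b) \<Rightarrow> real^'n \<Rightarrow> 'b" where
  "in_coords c f = f \<circ> inv_into (cdom c) (cmap c)"

definition is_chart :: "'a topology \<Rightarrow> ('a, 'n::finite) chart \<Rightarrow> bool" where
  "is_chart X c \<longleftrightarrow>
     openin X (cdom c) \<and> open (cimage c) \<and>
     homeomorphic_map (subtopology X (cdom c)) (top_of_set (cimage c)) (cmap c)"

definition transition :: "('a, 'n::finite) chart \<Rightarrow> ('a, 'n) chart \<Rightarrow> real^'n \<Rightarrow> real^'n" where
  "transition c d = in_coords c (cmap d)"

definition smooth_atlas :: "'a topology \<Rightarrow> ('a, 'n::finite) chart set \<Rightarrow> bool" where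
  "smooth_atlas X \<A> \<longleftrightarrow>
     (\<forall>c\<in>\<A>. is_chart X c) \<and>
     (\<Union>c\<in>\<A>. cdom c) = topspace X \<and>
     (\<forall>c\<in>\<A>. \<forall>d\<in>\<A>. smooth_on (transition c d) (cmap c ` (cdom c \<inter> cdom d)))"

text \<open>There is no boundary because charts map onto open subsets of Euclidean space.\<close>

definition closed_manifold :: "'a topology \<Rightarrow> ('a, 'n::finite) chart set \<Rightarrow> bool" where
  "closed_manifold X \<A> \<longleftrightarrow>
     Hausdorff_space X \<and> second_countable X \<and> compact_space X \<and> smooth_atlas X \<A>"


section \<open>Riemannian metrics\<close>

text \<open>
  A metric is given by its components: \<open>g c p $ i $ j\<close> is \<open>g(\<partial>\<^sub>i, \<partial>\<^sub>j)\<close> at \<open>p\<close> for the coordinate fields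
  of the chart \<open>c\<close>.  The last clause is the transformation law of covariant 2-tensors,
  \<open>g\<^sup>c\<^sub>i\<^sub>j = \<partial>\<^sub>i y\<^sup>k \<partial>\<^sub>j y\<^sup>l g\<^sup>d\<^sub>k\<^sub>l\<close>, where \<open>y\<close> denotes the \<open>d\<close>-coordinates as functions of the \<open>c\<close>-coordinates.
\<close>

type_synonym ('a, 'n) metric = "('a, 'n) chart \<Rightarrow> 'a \<Rightarrow> real^'n^'n"

definition riemannian_metric :: "('a, 'n::finite) chart set \<Rightarrow> ('a, 'n) metric \<Rightarrow> bool" where
  "riemannian_metric \<A> g \<longleftrightarrow>
     (\<forall>c\<in>\<A>. smooth_on (in_coords c (g c)) (cimage c)) \<and>
     (\<forall>c\<in>\<A>. \<forall>p\<in>cdom c. transpose (g c p) = g c p \<and> (\<forall>v. v \<noteq> 0 \<longrightarrow> v \<bullet> (g c p *v v) > 0)) \<and>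
     (\<forall>c\<in>\<A>. \<forall>d\<in>\<A>. \<forall>p\<in>cdom c \<inter> cdom d.
        let J = jacobian (transition c d) (at (cmap c p))
        in g c p = transpose J ** g d p ** J)"

text \<open>The following operators act on metrics and functions on an open subset of Euclidean space.\<close>

definition christoffel ::
  "(real^'n \<Rightarrow> real^'n^'n) \<Rightarrow> 'n \<Rightarrow> 'n \<Rightarrow> 'n \<Rightarrow> real^'n::finite \<Rightarrow> real" where
  "christoffel G k i j y =
     (1/2) * (\<Sum>l\<in>UNIV. matrix_inv (G y) $ k $ l *
       (partial_deriv i (\<lambda>z. G z $ j $ l) y + partial_deriv j (\<lambda>z. G z $ i $ l) y
        - partial_deriv l (\<lambda>z. G z $ i $ j) y))"

text \<open>\<open>riemann G l i j k\<close> is the component \<open>R\<^sup>l\<close> of \<open>R(\<partial>\<^sub>i, \<partial>\<^sub>j)\<partial>\<^sub>k = \<nabla>\<^sub>i\<nabla>\<^sub>j\<partial>\<^sub>k - \<nabla>\<^sub>j\<nabla>\<^sub>i\<partial>\<^sub>k\<close>.\<close>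

definition riemann ::
  "(real^'n \<Rightarrow> real^'n^'n) \<Rightarrow> 'n \<Rightarrow> 'n \<Rightarrow> 'n \<Rightarrow> 'n \<Rightarrow> real^'n::finite \<Rightarrow> real" where
  "riemann G l i j k y =
     partial_deriv i (christoffel G l j k) y - partial_deriv j (christoffel G l i k) y
     + (\<Sum>m\<in>UNIV. christoffel G l i m y * christoffel G m j k y
                 - christoffel G l j m y * christoffel G m i k y)"

text \<open>Trace of \<open>X \<mapsto> R(X, \<partial>\<^sub>j)\<partial>\<^sub>k\<close>; with this sign round spheres have positive Ricci curvature.\<close>

definition ricci_coords :: "(real^'n \<Rightarrow> real^'n^'n) \<Rightarrow> real^'n::finite \<Rightarrow> real^'n^'n" where
  "ricci_coords G y = (\<chi> j k. \<Sum>i\<in>UNIV. riemann G i i j k y)"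

definition hessian_coords ::
  "(real^'n \<Rightarrow> real^'n^'n) \<Rightarrow> (real^'n \<Rightarrow> real) \<Rightarrow> real^'n::finite \<Rightarrow> real^'n^'n" where
  "hessian_coords G f y =
     (\<chi> i j. partial_deriv i (partial_deriv j f) y
            - (\<Sum>k\<in>UNIV. christoffel G k i j y * partial_deriv k f y))"

definition laplacian_coords ::
  "(real^'n \<Rightarrow> real^'n^'n) \<Rightarrow> (real^'n \<Rightarrow> real) \<Rightarrow> real^'n::finite \<Rightarrow> real" where
  "laplacian_coords G f y =
     (\<Sum>i\<in>UNIV. \<Sum>j\<in>UNIV. matrix_inv (G y) $ i $ j * hessian_coords G f y $ i $ j)"

definition gradient_coords ::
  "(real^'n \<Rightarrow> real^'n^'n) \<Rightarrow> (real^'n \<Rightarrow> real) \<Rightarrow> real^'n::finite \<Rightarrow> real^'n" where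
  "gradient_coords G f y = matrix_inv (G y) *v (\<chi> j. partial_deriv j f y)"

text \<open>
  The same operators on the manifold, computed in the chart \<open>c\<close>.  \<open>laplacian\<close> and \<open>grad_norm_sq\<close>
  do not depend on the chart, and \<open>ricci\<close> transforms like the metric.
\<close>

definition ricci :: "('a, 'n::finite) metric \<Rightarrow> ('a, 'n) chart \<Rightarrow> 'a \<Rightarrow> real^'n^'n" where
  "ricci g c p = ricci_coords (in_coords c (g c)) (cmap c p)"

definition laplacian ::
  "('a, 'n::finite) metric \<Rightarrow> ('a, 'n) chart \<Rightarrow> ('a \<Rightarrow> real) \<Rightarrow> 'a \<Rightarrow> real" where
  "laplacian g c f p = laplacian_coords (in_coords c (g c)) (in_coords c f) (cmap c p)"

definition grad_norm_sq ::
  "('a, 'n::finite) metric \<Rightarrow> ('a, 'n) chart \<Rightarrow> ('a \<Rightarrow> real) \<Rightarrow> 'a \<Rightarrow> real" where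
  "grad_norm_sq g c f p =
     (let v = gradient_coords (in_coords c (g c)) (in_coords c f) (cmap c p)
      in v \<bullet> (g c p *v v))"


section \<open>Ricci flow and the evolution equation\<close>

definition ricci_flow ::
  "('a, 'n::finite) chart set \<Rightarrow> real \<Rightarrow> (real \<Rightarrow> ('a, 'n) metric) \<Rightarrow> bool" where
  "ricci_flow \<A> T g \<longleftrightarrow>
     (\<forall>t\<in>{0..T}. riemannian_metric \<A> (g t)) \<and>
     (\<forall>c\<in>\<A>. smooth_on (\<lambda>(t, y). in_coords c (g t c) y) ({0..T} \<times> cimage c)) \<and>
     (\<forall>c\<in>\<A>. \<forall>p\<in>cdom c. \<forall>t\<in>{0..T}.
        ((\<lambda>s. g s c p) has_vector_derivative (-2) *\<^sub>R ricci (g t) c p) (at t within {0..T}))"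

text \<open>
  Classical solutions of \<open>\<partial>\<^sub>t u = \<Delta> u + h(t) u\<^bsup>l-1\<^esup>\<close> on \<open>M \<times> [0,T]\<close>: \<open>u\<close> is of class \<open>C\<^sup>2\<close> in space
  (jointly continuously) up to \<open>t = 0\<close>, and smooth in space for \<open>t > 0\<close>.  Continuity of \<open>\<partial>\<^sub>t u\<close>
  follows from the equation.  Joint smoothness in \<open>(x,t)\<close> is not required: since \<open>u > 0\<close>, the equation
  would then force \<open>h\<close> to be smooth.  Smoothness in space for \<open>t > 0\<close> is what interior parabolic
  regularity gives for every positive \<open>C\<^bsup>2,1\<^esup>\<close> solution on a smooth background.
\<close>

definition classical_solution ::
  "('a, 'n::finite) chart set \<Rightarrow> real \<Rightarrow> (real \<Rightarrow> ('a, 'n) metric) \<Rightarrow> (real \<Rightarrow> real) \<Rightarrow> real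
     \<Rightarrow> ('a \<Rightarrow> real \<Rightarrow> real) \<Rightarrow> bool" where
  "classical_solution \<A> T g h l u \<longleftrightarrow>
     (\<forall>c\<in>\<A>. C_k_in_space 2 (\<lambda>t. in_coords c (\<lambda>x. u x t)) {0..T} (cimage c)) \<and>
     (\<forall>c\<in>\<A>. \<forall>k. C_k_in_space k (\<lambda>t. in_coords c (\<lambda>x. u x t)) {0<..T} (cimage c)) \<and>
     (\<forall>c\<in>\<A>. \<forall>x\<in>cdom c. \<forall>t\<in>{0..T}.
        (u x has_real_derivative
           laplacian (g t) c (\<lambda>z. u z t) x + h t * u x t powr (l - 1)) (at t within {0..T}))"

end

theory Submission
  imports Defs
begin

text \<open>
  The estimate is a maximum principle for \<open>F = t |\<nabla>u|\<^sup>2 + u\<^sup>2/2\<close>.  At \<open>t = 0\<close> the function \<open>F\<close> is \<open>u\<^sup>2/2\<close>,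
  so the claim says that \<open>F\<close> never exceeds its initial maximum, and this holds because
  \<open>\<partial>\<^sub>t F \<le> \<Delta>F\<close>.

  The differential inequality comes from two identities.  Bochner's formula
  \<open>\<Delta>|\<nabla>u|\<^sup>2 = 2|Hess u|\<^sup>2 + 2\<langle>\<nabla>u, \<nabla>\<Delta>u\<rangle> + 2 Ric(\<nabla>u, \<nabla>u)\<close> (lemma \<open>bochner_formula\<close>) has a Ricci term of no
  particular sign; but along the flow the inverse metric has time derivative \<open>2 Ric\<close> with raised indices,
  which adds the very same \<open>2 Ric(\<nabla>u, \<nabla>u)\<close> to \<open>\<partial>\<^sub>t|\<nabla>u|\<^sup>2\<close>.  The curvature cancels, and
  \<open>(\<partial>\<^sub>t - \<Delta>)|\<nabla>u|\<^sup>2 = -2|Hess u|\<^sup>2 + 2(l-1) h u\<^bsup>l-2\<^esup> |\<nabla>u|\<^sup>2 \<le> 0\<close>, while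
  \<open>(\<partial>\<^sub>t - \<Delta>)(u\<^sup>2/2) = -|\<nabla>u|\<^sup>2 + h u\<^sup>l \<le> -|\<nabla>u|\<^sup>2\<close>.  The factor \<open>t\<close> is chosen so that its derivative produces a
  \<open>+|\<nabla>u|\<^sup>2\<close> that the second inequality absorbs (lemma \<open>energy_subsolution\<close>).

  All tensor calculus is done with Christoffel symbols in an arbitrary fixed chart; the geometry enters
  through the compatibility of the connection with the inverse metric (\<open>metric_compat\<close>) and the
  antisymmetry of the curvature that follows from it (\<open>riemann_raised_antisym\<close>).  Charts have to be
  compared only once: \<open>F\<close> must be a function on the manifold for its maximum over the compact set
  \<open>M \<times> [0,T]\<close> to exist, which needs \<open>grad_norm_sq_chart_independent\<close>.

  At \<open>t = 0\<close> the solution is only \<open>C\<^sup>2\<close> in space, which makes \<open>F\<close> continuous there but gives no differential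
  inequality; the inequality is used at positive times only.  Nor is \<open>u\<close> assumed to be jointly
  smooth, so the evolution equation of \<open>\<nabla>u\<close> rests on an exchange of \<open>\<partial>\<^sub>t\<close> with \<open>\<partial>\<^sub>i\<close>
  (\<open>mixed_derivative\<close>) that asks only for the continuity of \<open>\<partial>\<^sub>i \<partial>\<^sub>t u\<close>.
\<close>

section \<open>Partial derivatives and regularity in space\<close>

lemma partial_deriv_eq:
  assumes "(f has_derivative f') (at y)"
  shows "partial_deriv i f y = f' (axis i 1)"
  using frechet_derivative_at[OF assms] by (simp add: partial_deriv_def)

lemma partial_deriv_const [simp]: "partial_deriv i (\<lambda>_. c) y = 0"
  by (rule partial_deriv_eq) (rule has_derivative_const)

lemma has_derivative_frechet:
  "f differentiable at y \<Longrightarrow> (f has_derivative frechet_derivative f (at y)) (at y)"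
  by (simp add: frechet_derivative_works)

lemma partial_deriv_add:
  assumes "f differentiable at y" "g differentiable at y"
  shows "partial_deriv i (\<lambda>z. f z + g z) y = partial_deriv i f y + partial_deriv i g y"
  unfolding partial_deriv_def[of i f] partial_deriv_def[of i g]
  by (rule partial_deriv_eq) (intro derivative_intros has_derivative_frechet assms)

lemma partial_deriv_diff:
  assumes "f differentiable at y" "g differentiable at y"
  shows "partial_deriv i (\<lambda>z. f z - g z) y = partial_deriv i f y - partial_deriv i g y"
  unfolding partial_deriv_def[of i f] partial_deriv_def[of i g]
  by (rule partial_deriv_eq) (intro derivative_intros has_derivative_frechet assms)

lemma partial_deriv_sum:
  assumes "\<And>a. a \<in> A \<Longrightarrow> f a differentiable at y"
  shows "partial_deriv i (\<lambda>z. \<Sum>a\<in>A. f a z) y = (\<Sum>a\<in>A. partial_deriv i (f a) y)"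
  unfolding partial_deriv_def[of i "f _"]
  by (rule partial_deriv_eq) (intro derivative_intros has_derivative_frechet assms)

lemma partial_deriv_mult:
  assumes "f differentiable at y" "g differentiable at y"
  shows "partial_deriv i (\<lambda>z. f z * g z) y = f y * partial_deriv i g y + partial_deriv i f y * g y"
  unfolding partial_deriv_def[of i f] partial_deriv_def[of i g]
  by (rule partial_deriv_eq) (intro derivative_intros has_derivative_frechet assms)

lemma partial_deriv_cmult:
  assumes "f differentiable at y"
  shows "partial_deriv i (\<lambda>z. c * f z) y = c * partial_deriv i f y"
  using partial_deriv_mult[of "\<lambda>_. c" y f i] assms by simp

lemma partial_deriv_inverse:
  assumes "f differentiable at y" "f y \<noteq> 0"
  shows "partial_deriv i (\<lambda>z. inverse (f z)) y = - (inverse (f y) * partial_deriv i f y * inverse (f y))"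
  unfolding partial_deriv_def[of i f]
  by (rule partial_deriv_eq) (intro Deriv.has_derivative_inverse has_derivative_frechet assms)

lemma has_derivative_powr_const:
  fixes f :: "'v::real_normed_vector \<Rightarrow> real"
  assumes "(f has_derivative f') (at y)" "0 < f y"
  shows "((\<lambda>z. f z powr a) has_derivative (\<lambda>v. a * f y powr (a - 1) * f' v)) (at y)"
proof -
  have "((\<lambda>x. x powr a) has_derivative (*) (a * f y powr (a - 1))) (at (f y))"
    using has_real_derivative_powr[OF assms(2), of a] by (simp add: has_field_derivative_def)
  then show ?thesis
    using has_derivative_compose[OF assms(1)] by blast
qed

lemma partial_deriv_powr:
  assumes "f differentiable at y" "0 < f y"
  shows "partial_deriv i (\<lambda>z. f z powr a) y = a * f y powr (a - 1) * partial_deriv i f y"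
  unfolding partial_deriv_def[of i f]
  by (rule partial_deriv_eq) (intro has_derivative_powr_const has_derivative_frechet assms)

lemma differentiable_cong_open:
  assumes "open V" "y \<in> V" "\<And>z. z \<in> V \<Longrightarrow> f z = g z"
  shows "f differentiable at y \<longleftrightarrow> g differentiable at y"
  unfolding differentiable_def
  using has_derivative_transform_within_open[OF _ assms(1,2), of f _ UNIV g]
    has_derivative_transform_within_open[OF _ assms(1,2), of g _ UNIV f] assms(3) by metis

lemma partial_deriv_cong:
  assumes "open V" "y \<in> V" "\<And>z. z \<in> V \<Longrightarrow> f z = g z"
  shows "partial_deriv i f y = partial_deriv i g y"
proof -
  have "(f has_derivative f') (at y) \<longleftrightarrow> (g has_derivative f') (at y)" for f'
    using has_derivative_transform_within_open[OF _ assms(1,2), of f _ UNIV g]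
      has_derivative_transform_within_open[OF _ assms(1,2), of g _ UNIV f] assms(3) by metis
  then show ?thesis unfolding partial_deriv_def frechet_derivative_def by simp
qed

text \<open>
  The values of a partial derivative on the open set \<open>V\<close> are determined by the values of the function on
  \<open>V\<close>.  The closure properties below compute a partial derivative on \<open>V\<close> and recognise the
  result, through this lemma, as an expression that the induction hypothesis covers.
\<close>

lemma C_k_in_space_cong:
  assumes "open V" "\<And>t y. t \<in> I \<Longrightarrow> y \<in> V \<Longrightarrow> v t y = w t y"
  shows "C_k_in_space k v I V \<longleftrightarrow> C_k_in_space k w I V"
  using assms(2)
proof (induction k arbitrary: v w)
  case 0
  then show ?case by (auto intro!: continuous_on_cong)
next
  case (Suc k)
  have "continuous_on (I \<times> V) (\<lambda>(t, y). v t y) \<longleftrightarrow> continuous_on (I \<times> V) (\<lambda>(t, y). w t y)"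
    using Suc.prems by (auto intro!: continuous_on_cong)
  moreover have "v t differentiable at y \<longleftrightarrow> w t differentiable at y" if "t \<in> I" "y \<in> V" for t y
    using Suc.prems that by (intro differentiable_cong_open[OF assms(1)]) auto
  moreover have "C_k_in_space k (\<lambda>t y. partial_deriv i (v t) y) I V
      \<longleftrightarrow> C_k_in_space k (\<lambda>t y. partial_deriv i (w t) y) I V" for i
    using Suc.prems by (intro Suc.IH partial_deriv_cong[OF assms(1)]) auto
  ultimately show ?case by simp
qed

lemma C_k_in_space_SucD: "C_k_in_space (Suc k) w I V \<Longrightarrow> C_k_in_space k w I V"
  by (induction k arbitrary: w) auto

lemma C_k_in_space_le: "C_k_in_space m w I V \<Longrightarrow> k \<le> m \<Longrightarrow> C_k_in_space k w I V"
  by (induction m) (auto simp del: C_k_in_space.simps dest: C_k_in_space_SucD simp: le_Suc_eq)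

lemma C_k_in_space_subset: "C_k_in_space k w I V \<Longrightarrow> J \<subseteq> I \<Longrightarrow> C_k_in_space k w J V"
  by (induction k arbitrary: w) (auto elim!: continuous_on_subset)

lemma C_k_in_space_cont: "C_k_in_space k w I V \<Longrightarrow> continuous_on (I \<times> V) (\<lambda>(t, y). w t y)"
  by (cases k) auto

lemma C_k_in_space_time:
  assumes "continuous_on I h" shows "C_k_in_space k (\<lambda>t y. h t) I V"
proof -
  have *: "continuous_on (I \<times> V) (\<lambda>(t, y). h t)" if "continuous_on I h" for h :: "real \<Rightarrow> real"
    using continuous_on_compose2[OF that continuous_on_fst[OF continuous_on_id], of "I \<times> V"]
    by (auto simp: case_prod_unfold)
  have c: "C_k_in_space k (\<lambda>t y. 0) I V" for k
    by (induction k) (auto simp: *)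
  show ?thesis by (cases k) (auto simp: c * assms)
qed

lemma C_k_in_space_add:
  assumes "open V"
  shows "C_k_in_space k v I V \<Longrightarrow> C_k_in_space k w I V \<Longrightarrow> C_k_in_space k (\<lambda>t y. v t y + w t y) I V"
proof (induction k arbitrary: v w)
  case 0
  then show ?case by (auto simp: case_prod_unfold intro!: continuous_intros)
next
  case (Suc k)
  have "C_k_in_space k (\<lambda>t y. partial_deriv i (\<lambda>y. v t y + w t y) y) I V" for i
  proof (subst C_k_in_space_cong[OF assms])
    show "partial_deriv i (\<lambda>y. v t y + w t y) y = partial_deriv i (v t) y + partial_deriv i (w t) y"
      if "t \<in> I" "y \<in> V" for t y using Suc.prems that by (auto intro!: partial_deriv_add)
  qed (use Suc in auto)
  then show ?case
    using Suc.prems by (auto simp: case_prod_unfold intro!: continuous_intros)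
qed

lemma C_k_in_space_mult:
  assumes "open V"
  shows "C_k_in_space k v I V \<Longrightarrow> C_k_in_space k w I V \<Longrightarrow> C_k_in_space k (\<lambda>t y. v t y * w t y) I V"
proof (induction k arbitrary: v w)
  case 0
  then show ?case by (auto simp: case_prod_unfold intro!: continuous_intros)
next
  case (Suc k)
  have "C_k_in_space k (\<lambda>t y. partial_deriv i (\<lambda>y. v t y * w t y) y) I V" for i
  proof (subst C_k_in_space_cong[OF assms])
    show "partial_deriv i (\<lambda>y. v t y * w t y) y
        = v t y * partial_deriv i (w t) y + partial_deriv i (v t) y * w t y"
      if "t \<in> I" "y \<in> V" for t y using Suc.prems that by (auto intro!: partial_deriv_mult)
    show "C_k_in_space k (\<lambda>t y. v t y * partial_deriv i (w t) y + partial_deriv i (v t) y * w t y) I V"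
      using Suc.prems Suc.prems[THEN C_k_in_space_SucD]
      by (intro C_k_in_space_add[OF assms] Suc.IH) auto
  qed
  then show ?case
    using Suc.prems by (auto simp: case_prod_unfold intro!: continuous_intros differentiable_mult)
qed

lemma C_k_in_space_uminus:
  assumes "open V" "C_k_in_space k v I V" shows "C_k_in_space k (\<lambda>t y. - v t y) I V"
  using C_k_in_space_mult[OF assms(1) C_k_in_space_time[of I "\<lambda>_. -1"] assms(2)] by simp

lemma C_k_in_space_diff:
  assumes "open V" "C_k_in_space k v I V" "C_k_in_space k w I V"
  shows "C_k_in_space k (\<lambda>t y. v t y - w t y) I V"
  using C_k_in_space_add[OF assms(1,2) C_k_in_space_uminus[OF assms(1,3)]] by simp

lemma C_k_in_space_sum:
  assumes "open V" "\<And>a. a \<in> A \<Longrightarrow> C_k_in_space k (v a) I V"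
  shows "C_k_in_space k (\<lambda>t y. \<Sum>a\<in>A. v a t y) I V"
  using assms(2)
  by (induction A rule: infinite_finite_induct)
    (auto intro!: C_k_in_space_add[OF assms(1)] C_k_in_space_time)

lemma C_k_in_space_prod:
  assumes "open V" "\<And>a. a \<in> A \<Longrightarrow> C_k_in_space k (v a) I V"
  shows "C_k_in_space k (\<lambda>t y. \<Prod>a\<in>A. v a t y) I V"
  using assms(2)
  by (induction A rule: infinite_finite_induct)
    (auto intro!: C_k_in_space_mult[OF assms(1)] C_k_in_space_time)

lemma C_k_in_space_inverse:
  assumes "open V" "\<And>t y. t \<in> I \<Longrightarrow> y \<in> V \<Longrightarrow> v t y \<noteq> 0"
  shows "C_k_in_space k v I V \<Longrightarrow> C_k_in_space k (\<lambda>t y. inverse (v t y)) I V"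
proof (induction k)
  case 0
  then show ?case using assms by (auto simp: case_prod_unfold intro!: continuous_intros)
next
  case (Suc k)
  have "C_k_in_space k (\<lambda>t y. partial_deriv i (\<lambda>y. inverse (v t y)) y) I V" for i
  proof (subst C_k_in_space_cong[OF assms(1)])
    show "partial_deriv i (\<lambda>y. inverse (v t y)) y
        = - (inverse (v t y) * partial_deriv i (v t) y * inverse (v t y))"
      if "t \<in> I" "y \<in> V" for t y using Suc.prems that assms(2) by (auto intro!: partial_deriv_inverse)
    show "C_k_in_space k (\<lambda>t y. - (inverse (v t y) * partial_deriv i (v t) y * inverse (v t y))) I V"
      using Suc.prems Suc.IH[OF C_k_in_space_SucD[OF Suc.prems]]
      by (intro C_k_in_space_uminus[OF assms(1)] C_k_in_space_mult[OF assms(1)]) auto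
  qed
  then show ?case
    using Suc.prems assms by (auto simp: case_prod_unfold intro!: continuous_intros differentiable_inverse)
qed

lemma C_k_in_space_powr:
  assumes "open V" "\<And>t y. t \<in> I \<Longrightarrow> y \<in> V \<Longrightarrow> 0 < v t y"
  shows "C_k_in_space k v I V \<Longrightarrow> C_k_in_space k (\<lambda>t y. v t y powr a) I V"
proof -
  have cont: "continuous_on (I \<times> V) (\<lambda>(t, y). v t y powr a)"
    if "continuous_on (I \<times> V) (\<lambda>(t, y). v t y)" for a
  proof -
    have "\<forall>p\<in>I \<times> V. (case p of (t, y) \<Rightarrow> v t y) \<noteq> 0" using assms(2) by fastforce
    from continuous_on_powr[OF that continuous_on_const this]
    show ?thesis by (simp add: case_prod_unfold)
  qed
  show "C_k_in_space k v I V \<Longrightarrow> C_k_in_space k (\<lambda>t y. v t y powr a) I V"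
  proof (induction k arbitrary: a)
    case 0
    then show ?case using cont by simp
  next
    case (Suc k)
    have d: "(\<lambda>y. v t y powr a) differentiable at y
        \<and> partial_deriv i (\<lambda>y. v t y powr a) y = a * v t y powr (a - 1) * partial_deriv i (v t) y"
      if ty: "t \<in> I" "y \<in> V" for t y i
    proof -
      have "v t differentiable at y" using Suc.prems ty by simp
      then show ?thesis
        using has_derivative_powr_const[of "v t", OF has_derivative_frechet] assms(2)[OF ty]
          partial_deriv_powr[of "v t"]
        unfolding differentiable_def by blast
    qed
    have "C_k_in_space k (\<lambda>t y. partial_deriv i (\<lambda>y. v t y powr a) y) I V" for i
    proof (subst C_k_in_space_cong[OF assms(1)])
      show "partial_deriv i (\<lambda>y. v t y powr a) y = a * v t y powr (a - 1) * partial_deriv i (v t) y"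
        if "t \<in> I" "y \<in> V" for t y using d that by blast
      show "C_k_in_space k (\<lambda>t y. a * v t y powr (a - 1) * partial_deriv i (v t) y) I V"
        using Suc.prems Suc.IH[OF C_k_in_space_SucD[OF Suc.prems]]
        by (intro C_k_in_space_mult[OF assms(1)] C_k_in_space_time) auto
    qed
    then show ?case using d cont[OF C_k_in_space_cont[OF Suc.prems]] by simp
  qed
qed

lemma C_k_in_space_partial_deriv:
  "C_k_in_space (Suc k) w I V \<Longrightarrow> C_k_in_space k (\<lambda>t y. partial_deriv i (w t) y) I V"
  by simp

lemma C_k_in_space_differentiable:
  "C_k_in_space k w I V \<Longrightarrow> 0 < k \<Longrightarrow> t \<in> I \<Longrightarrow> y \<in> V \<Longrightarrow> w t differentiable at y"
  by (cases k) auto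

text \<open>
  A single time slice, regarded as a family that is constant in time.  With \<open>J = {0}\<close> this turns
  \<open>C_k_in_space\<close> into a notion of regularity for functions on \<open>V\<close> alone, in which the calculus at a fixed
  time is carried out.
\<close>

lemma C_k_in_space_at:
  "C_k_in_space k w I V \<Longrightarrow> t \<in> I \<Longrightarrow> C_k_in_space k (\<lambda>_. w t) J V"
proof (induction k arbitrary: w)
  case (0 w)
  have "continuous_on (J \<times> V) (\<lambda>p. (\<lambda>(t, y). w t y) (t, snd p))"
    by (rule continuous_on_compose2[OF C_k_in_space_cont[OF 0(1)]])
      (use 0 in \<open>auto intro!: continuous_intros\<close>)
  then show ?case by (simp add: case_prod_unfold)
next
  case (Suc k)
  have "continuous_on (J \<times> V) (\<lambda>p. (\<lambda>(t, y). w t y) (t, snd p))"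
    by (rule continuous_on_compose2[OF C_k_in_space_cont[OF Suc.prems(1)]])
      (use Suc.prems in \<open>auto intro!: continuous_intros\<close>)
  then show ?case using Suc by (auto simp add: case_prod_unfold)
qed

lemma partial_deriv_has_real_derivative:
  assumes "f differentiable at (z + x *\<^sub>R axis i 1)"
  shows "((\<lambda>x. f (z + x *\<^sub>R axis i 1)) has_real_derivative partial_deriv i f (z + x *\<^sub>R axis i 1)) (at x within S)"
proof -
  have "((\<lambda>x. f (z + x *\<^sub>R axis i 1)) has_derivative
     (\<lambda>h. frechet_derivative f (at (z + x *\<^sub>R axis i 1)) (h *\<^sub>R axis i 1))) (at x within S)"
    by (rule has_derivative_compose[where g = f], (auto intro!: derivative_eq_intros)[1])
      (rule has_derivative_frechet[OF assms])
  moreover have "(\<lambda>h. frechet_derivative f (at (z + x *\<^sub>R axis i 1)) (h *\<^sub>R axis i 1))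
     = (*) (partial_deriv i f (z + x *\<^sub>R axis i 1))"
    using linear_frechet_derivative[OF assms]
    by (auto simp: partial_deriv_def linear_cmul mult.commute)
  ultimately show ?thesis by (simp add: has_field_derivative_def)
qed

text \<open>
  The mean value theorem without an order on the end points, so that increments of either sign are treated
  at once.
\<close>

lemma mvt_signed:
  fixes f :: "real \<Rightarrow> real"
  assumes "a \<noteq> b" "\<And>x. x \<in> closed_segment a b \<Longrightarrow> (f has_real_derivative f' x) (at x within closed_segment a b)"
  shows "\<exists>x\<in>closed_segment a b. f b - f a = (b - a) * f' x"
proof -
  have *: "\<exists>x\<in>{a..b}. f b - f a = (b - a) * f' x"
    if "a < b" "\<And>x. x \<in> {a..b} \<Longrightarrow> (f has_real_derivative f' x) (at x within {a..b})" for a b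
  proof -
    have "\<exists>x\<in>{a<..<b}. f b - f a = (*) (f' x) (b - a)"
      by (rule mvt_simple[OF that(1)]) (use that(2) in \<open>auto simp: has_field_derivative_def\<close>)
    then show ?thesis by (auto simp: mult.commute)
  qed
  show ?thesis
  proof (cases "a < b")
    case True
    then show ?thesis using * [of a b] assms(2) by (simp add: closed_segment_eq_real_ivl)
  next
    case False
    then have ba: "b < a" using assms(1) by simp
    then have "closed_segment a b = {b..a}" by (simp add: closed_segment_eq_real_ivl)
    with *[OF ba] assms(2) obtain x where "x \<in> closed_segment a b" "f a - f b = (a - b) * f' x" by auto
    then show ?thesis by (intro bexI[of _ x]) (auto simp: algebra_simps)
  qed
qed

text \<open>
  The derivatives in time and space may be exchanged as soon as \<open>\<partial>\<^sub>i \<partial>\<^sub>t u\<close> is continuous.  The reason is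
  the mean value theorem, applied first in time and then in space to the double difference
  \<open>[u(s, y + \<eta>e\<^sub>i) - u(s, y)] - [u(t, y + \<eta>e\<^sub>i) - u(t, y)] = (s - t) \<eta> \<partial>\<^sub>i w(\<tau>, y + xe\<^sub>i)\<close>, where the value of
  \<open>\<partial>\<^sub>i w\<close> is within \<open>\<epsilon>\<close> of \<open>\<partial>\<^sub>i w(t, y)\<close>.  Division by \<open>\<eta>\<close> and the limit \<open>\<eta> \<rightarrow> 0\<close> keep the bound \<open>\<epsilon> |s - t|\<close>,
  which is uniform in \<open>\<eta>\<close>.
\<close>

lemma mixed_derivative:
  fixes u w :: "real \<Rightarrow> real^'n::finite \<Rightarrow> real"
  assumes V: "open V" "y \<in> V" and I: "convex I" "t \<in> I"
    and u: "\<And>s. s \<in> I \<Longrightarrow> u s differentiable at y"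
    and ut: "\<And>s z. s \<in> I \<Longrightarrow> z \<in> V \<Longrightarrow> ((\<lambda>s. u s z) has_real_derivative w s z) (at s within I)"
    and w: "C_k_in_space 1 w I V"
  shows "((\<lambda>s. partial_deriv i (u s) y) has_real_derivative partial_deriv i (w t) y) (at t within I)"
proof -
  let ?e = "axis i (1::real) :: real^'n"
  let ?wi = "\<lambda>(s, z). partial_deriv i (w s) z"
  have wd: "\<And>s z. s \<in> I \<Longrightarrow> z \<in> V \<Longrightarrow> w s differentiable at z"
    and wc: "continuous_on (I \<times> V) ?wi" using w by auto
  have main: "\<exists>d>0. \<forall>s\<in>I. \<bar>s - t\<bar> < d \<longrightarrow>
      \<bar>partial_deriv i (u s) y - partial_deriv i (u t) y - (s - t) * partial_deriv i (w t) y\<bar> \<le> \<epsilon> * \<bar>s - t\<bar>"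
    if "\<epsilon> > 0" for \<epsilon>
  proof -
    have "\<exists>d>0. \<forall>p\<in>I \<times> V. dist p (t, y) < d \<longrightarrow> dist (?wi p) (?wi (t, y)) < \<epsilon>"
      using wc I V that unfolding continuous_on_iff by blast
    then obtain d where d: "d > 0" "\<And>s z. s \<in> I \<Longrightarrow> z \<in> V \<Longrightarrow> dist (s, z) (t, y) < d \<Longrightarrow>
        \<bar>partial_deriv i (w s) z - partial_deriv i (w t) y\<bar> < \<epsilon>"
      by (fastforce simp: dist_real_def)
    obtain r where r: "r > 0" "ball y r \<subseteq> V" using V by (meson open_contains_ball)
    \<comment> \<open>\<open>r\<close> keeps the points in \<open>V\<close>; \<open>d/2\<close> for the space shift and for the time shift stay below \<open>d\<close> together.\<close>
    define \<rho> where "\<rho> = min r (d/2)"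
    have \<rho>: "\<rho> > 0" using d r by (simp add: \<rho>_def)
    show ?thesis
    proof (intro exI[of _ "d/2"] conjI ballI impI)
      fix s assume s: "s \<in> I" "\<bar>s - t\<bar> < d/2"
      let ?c = "partial_deriv i (w t) y"
      have zV: "y + x *\<^sub>R ?e \<in> V" if "\<bar>x\<bar> < \<rho>" for x
        using that r by (intro subsetD[OF r(2)]) (auto simp: dist_norm \<rho>_def)
      have seg: "closed_segment t s \<subseteq> I" using I s by (simp add: closed_segment_subset)
      have bound: "\<bar>(u s (y + \<eta> *\<^sub>R ?e) - u s y) / \<eta> - (u t (y + \<eta> *\<^sub>R ?e) - u t y) / \<eta> - (s - t) * ?c\<bar>
          \<le> \<epsilon> * \<bar>s - t\<bar>" if \<eta>: "\<eta> \<noteq> 0" "\<bar>\<eta>\<bar> < \<rho>" for \<eta>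
      proof (cases "s = t")
        case False
        have yV: "y + \<eta> *\<^sub>R ?e \<in> V" using zV that by blast
        have "\<exists>\<tau>\<in>closed_segment t s. (u s (y + \<eta> *\<^sub>R ?e) - u s y) - (u t (y + \<eta> *\<^sub>R ?e) - u t y)
            = (s - t) * (w \<tau> (y + \<eta> *\<^sub>R ?e) - w \<tau> y)"
          by (rule mvt_signed[of t s "\<lambda>\<tau>. u \<tau> (y + \<eta> *\<^sub>R ?e) - u \<tau> y" "\<lambda>\<tau>. w \<tau> (y + \<eta> *\<^sub>R ?e) - w \<tau> y"])
            (use False seg yV V in \<open>auto intro!: derivative_intros DERIV_subset[OF ut]\<close>)
        then obtain \<tau> where \<tau>: "\<tau> \<in> closed_segment t s"
          "(u s (y + \<eta> *\<^sub>R ?e) - u s y) - (u t (y + \<eta> *\<^sub>R ?e) - u t y) = (s - t) * (w \<tau> (y + \<eta> *\<^sub>R ?e) - w \<tau> y)"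
          by blast
        have \<tau>I: "\<tau> \<in> I" using \<tau> seg by blast
        have small: "\<bar>x\<bar> < \<rho>" if "x \<in> closed_segment 0 \<eta>" for x
          using that \<eta> by (auto simp: closed_segment_eq_real_ivl split: if_splits)
        have "\<exists>x\<in>closed_segment 0 \<eta>. w \<tau> (y + \<eta> *\<^sub>R ?e) - w \<tau> (y + 0 *\<^sub>R ?e)
            = (\<eta> - 0) * partial_deriv i (w \<tau>) (y + x *\<^sub>R ?e)"
          by (rule mvt_signed[of 0 \<eta> "\<lambda>x. w \<tau> (y + x *\<^sub>R ?e)"])
            (use \<eta> \<tau>I small zV in \<open>auto intro!: partial_deriv_has_real_derivative wd\<close>)
        then obtain x where x: "x \<in> closed_segment 0 \<eta>"
          "w \<tau> (y + \<eta> *\<^sub>R ?e) - w \<tau> y = \<eta> * partial_deriv i (w \<tau>) (y + x *\<^sub>R ?e)" by auto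
        have "dist (\<tau>, y + x *\<^sub>R ?e) (t, y) \<le> \<bar>\<tau> - t\<bar> + \<bar>x\<bar>"
          using sqrt_sum_squares_le_sum_abs[of "\<tau> - t" x] by (simp add: dist_norm norm_Pair)
        also have "\<dots> < d/2 + d/2"
          using \<tau>(1) s small[OF x(1)]
          by (intro add_strict_mono) (auto simp: \<rho>_def closed_segment_eq_real_ivl split: if_splits)
        finally have "\<bar>partial_deriv i (w \<tau>) (y + x *\<^sub>R ?e) - ?c\<bar> < \<epsilon>"
          using d(2) \<tau>I zV small[OF x(1)] by simp
        then have "\<bar>s - t\<bar> * \<bar>partial_deriv i (w \<tau>) (y + x *\<^sub>R ?e) - ?c\<bar> \<le> \<bar>s - t\<bar> * \<epsilon>"
          by (intro mult_left_mono) auto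
        moreover have "(u s (y + \<eta> *\<^sub>R ?e) - u s y) / \<eta> - (u t (y + \<eta> *\<^sub>R ?e) - u t y) / \<eta> - (s - t) * ?c
            = (s - t) * (partial_deriv i (w \<tau>) (y + x *\<^sub>R ?e) - ?c)"
          using \<tau>(2) x(2) \<eta>(1) by (simp add: diff_divide_distrib[symmetric]) (simp add: algebra_simps)
        ultimately show ?thesis by (simp add: abs_mult mult.commute)
      qed simp
      have lim: "((\<lambda>\<eta>. (u s (y + \<eta> *\<^sub>R ?e) - u s y) / \<eta>) \<longlongrightarrow> partial_deriv i (u s) y) (at 0)"
        if "s \<in> I" for s
        using partial_deriv_has_real_derivative[of "u s" y 0 i UNIV] u[OF that]
        by (simp add: DERIV_def)
      have ev: "\<forall>\<^sub>F \<eta> in at 0. \<bar>(u s (y + \<eta> *\<^sub>R ?e) - u s y) / \<eta> - (u t (y + \<eta> *\<^sub>R ?e) - u t y) / \<eta> - (s - t) * ?c\<bar>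
          \<le> \<epsilon> * \<bar>s - t\<bar>"
        unfolding eventually_at using \<rho> bound by (intro exI[of _ \<rho>]) (auto simp: dist_real_def)
      have "((\<lambda>\<eta>. \<bar>(u s (y + \<eta> *\<^sub>R ?e) - u s y) / \<eta> - (u t (y + \<eta> *\<^sub>R ?e) - u t y) / \<eta> - (s - t) * ?c\<bar>)
          \<longlongrightarrow> \<bar>partial_deriv i (u s) y - partial_deriv i (u t) y - (s - t) * ?c\<bar>) (at 0)"
        by (intro tendsto_intros lim s I)
      from tendsto_upperbound[OF this ev]
      show "\<bar>partial_deriv i (u s) y - partial_deriv i (u t) y - (s - t) * ?c\<bar> \<le> \<epsilon> * \<bar>s - t\<bar>" by simp
    qed (use d in auto)
  qed
  show ?thesis
    unfolding has_field_derivative_def has_derivative_within_alt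
    using main by (auto simp: bounded_linear_mult_right dist_real_def mult.commute)
qed

text \<open>
  This is \<open>mixed_derivative\<close> for the family \<open>s \<mapsto> f(\<cdot> + s e\<^sub>j)\<close>: its derivative in the parameter \<open>s\<close> is
  \<open>\<partial>\<^sub>j f\<close>, so the second space direction plays the part of time.
\<close>

lemma partial_deriv_commute:
  fixes f :: "real^'n::finite \<Rightarrow> real"
  assumes V: "open V" "y \<in> V" and f: "C_k_in_space 2 (\<lambda>_. f) {0} V"
  shows "partial_deriv i (partial_deriv j f) y = partial_deriv j (partial_deriv i f) y"
proof -
  let ?e = "axis j (1::real) :: real^'n"
  have fd: "\<And>z. z \<in> V \<Longrightarrow> f differentiable at z"
    and fd2: "\<And>z k. z \<in> V \<Longrightarrow> partial_deriv k f differentiable at z"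
    and fc: "\<And>k m. continuous_on ({0::real} \<times> V) (\<lambda>(t, y). partial_deriv m (partial_deriv k f) y)"
    and fc1: "\<And>k. continuous_on ({0::real} \<times> V) (\<lambda>(t, y). partial_deriv k f y)"
    using f by (auto simp: numeral_2_eq_2)
  have fc': "continuous_on V (g::_ \<Rightarrow> real)" if "continuous_on ({0::real} \<times> V) (\<lambda>(t, y). g y)" for g
    using continuous_on_compose2[OF that, of V "\<lambda>y. (0, y)"] by (force intro!: continuous_on_Pair continuous_on_const continuous_on_id)
  obtain r where r: "r > 0" "ball y r \<subseteq> V" using V by (meson open_contains_ball)
  let ?I = "{- r/2 <..< r/2}" and ?B = "ball y (r/2)"
  have inV: "z + s *\<^sub>R ?e \<in> V" if "s \<in> ?I" "z \<in> ?B" for s z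
  proof -
    have "dist y (z + s *\<^sub>R ?e) \<le> dist y z + \<bar>s\<bar>"
      using dist_triangle[of y "z + s *\<^sub>R ?e" z] by (simp add: dist_norm)
    also have "\<dots> < r" using that by (auto simp: abs_less_iff)
    finally show ?thesis using r(2) by auto
  qed
  have shift: "(\<lambda>z. g (z + s *\<^sub>R ?e)) differentiable at z
      \<and> partial_deriv k (\<lambda>z. g (z + s *\<^sub>R ?e)) z = partial_deriv k g (z + s *\<^sub>R ?e)"
    if "g differentiable at (z + s *\<^sub>R ?e)" for g :: "real^'n \<Rightarrow> real" and z s k
  proof -
    have "((\<lambda>z. g (z + s *\<^sub>R ?e)) has_derivative (\<lambda>v. frechet_derivative g (at (z + s *\<^sub>R ?e)) v)) (at z)"
      by (rule has_derivative_compose[where g = g], (auto intro!: derivative_eq_intros)[1])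
        (rule has_derivative_frechet[OF that])
    then show ?thesis
      using partial_deriv_eq[of _ _ z k] by (auto simp: differentiable_def partial_deriv_def[of _ g])
  qed
  have "((\<lambda>s. partial_deriv i (\<lambda>z. f (z + s *\<^sub>R ?e)) y) has_real_derivative
      partial_deriv i (\<lambda>z. partial_deriv j f (z + 0 *\<^sub>R ?e)) y) (at 0 within ?I)"
  proof (rule mixed_derivative[of ?B])
    show "((\<lambda>s. f (z + s *\<^sub>R ?e)) has_real_derivative partial_deriv j f (z + s *\<^sub>R ?e)) (at s within ?I)"
      if "s \<in> ?I" "z \<in> ?B" for s z
      by (rule partial_deriv_has_real_derivative) (use inV[OF that] fd in auto)
    have c: "continuous_on (?I \<times> ?B) (\<lambda>(s, z). g (z + s *\<^sub>R ?e))" if "continuous_on V g"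
      for g :: "real^'n \<Rightarrow> real"
      unfolding case_prod_unfold
      by (rule continuous_on_compose2[OF that]) (use inV in \<open>auto intro!: continuous_intros\<close>)
    have "continuous_on (?I \<times> ?B) (\<lambda>(s, z). partial_deriv k (\<lambda>z. partial_deriv j f (z + s *\<^sub>R ?e)) z)" for k
      by (rule continuous_on_eq[OF c[OF fc'[OF fc]]]) (use inV shift fd2 in auto)
    then show "C_k_in_space 1 (\<lambda>s z. partial_deriv j f (z + s *\<^sub>R ?e)) ?I ?B"
      using c[OF fc'[OF fc1]] inV shift fd2 by auto
  qed (use r inV shift fd in \<open>auto\<close>)
  moreover have "((\<lambda>s. partial_deriv i (\<lambda>z. f (z + s *\<^sub>R ?e)) y) has_real_derivative
      partial_deriv j (partial_deriv i f) y) (at 0 within ?I)"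
  proof (rule has_field_derivative_transform_within[where d = "r/2"])
    show "((\<lambda>s. partial_deriv i f (y + s *\<^sub>R ?e)) has_real_derivative partial_deriv j (partial_deriv i f) y) (at 0 within ?I)"
      using partial_deriv_has_real_derivative[of "partial_deriv i f" y 0 j] fd2 V by auto
    show "partial_deriv i f (y + s *\<^sub>R ?e) = partial_deriv i (\<lambda>z. f (z + s *\<^sub>R ?e)) y" if "s \<in> ?I" for s
      using shift fd inV[OF that, of y] r by auto
  qed (use r in auto)
  moreover have "at (0::real) within ?I \<noteq> bot"
    using r at_within_open[of 0 ?I] by auto
  ultimately show ?thesis using has_field_derivative_unique by fastforce
qed

section \<open>Positive semidefinite forms and inverse matrices\<close>

text \<open>
  Symmetric Gaussian elimination, one index at a time.  If \<open>P a a > 0\<close>, subtracting the rank-one form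
  \<open>P i a P j a / P a a\<close> clears row and column \<open>a\<close>; what remains is positive semidefinite, because its value
  at \<open>v\<close> is the minimum over \<open>c\<close> of the form at \<open>v + c e\<^sub>a\<close>.  If \<open>P a a = 0\<close>, semidefiniteness forces row
  and column \<open>a\<close> to vanish already.
\<close>

lemma psd_decomposition_on:
  fixes P :: "'n::finite \<Rightarrow> 'n \<Rightarrow> real"
  assumes "finite S"
    and "\<And>i j. P i j = P j i"
    and "\<And>v. 0 \<le> (\<Sum>i\<in>UNIV. \<Sum>j\<in>UNIV. v i * v j * P i j)"
    and "\<And>i j. i \<notin> S \<Longrightarrow> P i j = 0"
  shows "\<exists>w. \<forall>i j. P i j = (\<Sum>k\<in>S. w k i * w k j)"
  using assms
proof (induction S arbitrary: P rule: finite_induct)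
  case empty
  then show ?case by auto
next
  case (insert a S)
  note sym = insert.prems(1) and psd = insert.prems(2) and supp = insert.prems(3)
  have shift: "(\<Sum>i\<in>UNIV. \<Sum>j\<in>UNIV. (v i + c * of_bool (i = a)) * (v j + c * of_bool (j = a)) * P i j)
      = (\<Sum>i\<in>UNIV. \<Sum>j\<in>UNIV. v i * v j * P i j) + 2 * c * (\<Sum>i\<in>UNIV. v i * P i a) + c\<^sup>2 * P a a" for v c
  proof -
    have "(\<Sum>i\<in>UNIV. \<Sum>j\<in>UNIV. (v i + c * of_bool (i = a)) * (v j + c * of_bool (j = a)) * P i j)
      = (\<Sum>i\<in>UNIV. \<Sum>j\<in>UNIV. v i * v j * P i j + (if j = a then c * v i * P i j else 0)
        + (if i = a then c * v j * P i j else 0)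
        + (if i = a then (if j = a then c\<^sup>2 * P i j else 0) else 0))"
      by (intro sum.cong refl) (simp add: algebra_simps power2_eq_square)
    moreover have "(\<Sum>i\<in>UNIV. \<Sum>j\<in>UNIV. if j = a then c * v i * P i j else 0) = c * (\<Sum>i\<in>UNIV. v i * P i a)"
      by (simp add: sum_distrib_left mult.assoc)
    moreover have "(\<Sum>i\<in>UNIV. \<Sum>j\<in>UNIV. if i = a then c * v j * P i j else 0) = c * (\<Sum>i\<in>UNIV. v i * P i a)"
      by (subst sum.swap) (simp add: sum_distrib_left mult.assoc sym[of a])
    moreover have "(\<Sum>i\<in>UNIV. \<Sum>j\<in>UNIV. if i = a then (if j = a then c\<^sup>2 * P i j else 0) else 0) = c\<^sup>2 * P a a"
      by (subst sum.swap) simp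
    ultimately show ?thesis by (simp add: sum.distrib)
  qed
  have paa: "0 \<le> P a a"
    using psd[of "\<lambda>i. of_bool (i = a)"] shift[of "\<lambda>_. 0" 1] by simp
  show ?case
  proof (cases "P a a = 0")
    case True
    have zero: "P i a = 0" for i
    proof (rule ccontr)
      assume "P i a \<noteq> 0"
      let ?v = "\<lambda>k. of_bool (k = i)"
      have 1: "(\<Sum>k\<in>UNIV. ?v k * P k a) = P i a" by (simp add: of_bool_def if_distrib[of "\<lambda>x. x * _"] cong: if_cong)
      define z where "z = (\<Sum>k\<in>UNIV. \<Sum>j\<in>UNIV. ?v k * ?v j * P k j)"
      have "0 \<le> z + 2 * c * P i a" for c
        unfolding z_def using psd[of "\<lambda>k. ?v k + c * of_bool (k = a)"] shift[of ?v c] True 1 by simp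
      \<comment> \<open>This value of \<open>c\<close> makes the right-hand side equal to \<open>-1\<close>.\<close>
      from this[of "(- z - 1) / (2 * P i a)"]
      show False using \<open>P i a \<noteq> 0\<close> by (simp add: field_simps)
    qed
    have "\<exists>w. \<forall>i j. P i j = (\<Sum>k\<in>S. w k i * w k j)"
    proof (rule insert.IH[OF sym psd])
      show "P i j = 0" if "i \<notin> S" for i j
        using that supp zero[of j] sym[of i j] by (cases "i = a") auto
    qed
    then obtain w where w: "\<And>i j. P i j = (\<Sum>k\<in>S. w k i * w k j)" by blast
    have "(\<Sum>k\<in>S. (w(a := \<lambda>_. 0)) k i * (w(a := \<lambda>_. 0)) k j) = (\<Sum>k\<in>S. w k i * w k j)" for i j
      using insert.hyps by (intro sum.cong) auto
    then show ?thesis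
      using insert.hyps w by (intro exI[of _ "w(a := \<lambda>_. 0)"]) simp
  next
    case False
    with paa have pos: "0 < P a a" by simp
    define P' where "P' i j = P i j - P i a * P j a / P a a" for i j
    have "\<exists>w. \<forall>i j. P' i j = (\<Sum>k\<in>S. w k i * w k j)"
    proof (rule insert.IH)
      show "P' i j = P' j i" for i j by (simp add: P'_def sym[of i j] mult.commute)
      show "P' i j = 0" if "i \<notin> S" for i j
        using that supp pos by (cases "i = a") (auto simp: P'_def sym[of a j])
      show "0 \<le> (\<Sum>i\<in>UNIV. \<Sum>j\<in>UNIV. v i * v j * P' i j)" for v
      proof -
        let ?s = "\<Sum>i\<in>UNIV. v i * P i a"
        have "(\<Sum>i\<in>UNIV. \<Sum>j\<in>UNIV. v i * v j * P' i j)
            = (\<Sum>i\<in>UNIV. \<Sum>j\<in>UNIV. v i * v j * P i j) - ?s * ?s / P a a"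
          unfolding P'_def sum_product sum_divide_distrib
          by (simp add: sum_subtractf[symmetric] algebra_simps)
        also have "\<dots> = (\<Sum>i\<in>UNIV. \<Sum>j\<in>UNIV. v i * v j * P i j) + 2 * (- ?s / P a a) * ?s + (- ?s / P a a)\<^sup>2 * P a a"
          using pos by (simp add: power2_eq_square)
        also have "\<dots> \<ge> 0" using psd[of "\<lambda>i. v i + (- ?s / P a a) * of_bool (i = a)"] unfolding shift .
        finally show ?thesis .
      qed
    qed
    then obtain w where w: "\<And>i j. P' i j = (\<Sum>k\<in>S. w k i * w k j)" by blast
    let ?w = "w(a := \<lambda>i. P i a / sqrt (P a a))"
    have "(\<Sum>k\<in>insert a S. ?w k i * ?w k j) = P i j" for i j
    proof -
      have "(\<Sum>k\<in>S. ?w k i * ?w k j) = P' i j"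
        unfolding w using insert.hyps by (intro sum.cong) auto
      then have "(\<Sum>k\<in>insert a S. ?w k i * ?w k j) = P i a / sqrt (P a a) * (P j a / sqrt (P a a)) + P' i j"
        using insert.hyps by simp
      also have "\<dots> = P i j" using pos by (simp add: P'_def)
      finally show ?thesis .
    qed
    then show ?thesis by (intro exI[of _ ?w]) simp
  qed
qed

text \<open>
  Writing the inverse metric as a sum of squares of linear forms turns contractions with it into sums of
  values of quadratic forms, without orthonormal frames or eigenvalues.
\<close>

lemma psd_decomposition:
  fixes P :: "'n::finite \<Rightarrow> 'n \<Rightarrow> real"
  assumes "\<And>i j. P i j = P j i"
    and "\<And>v. 0 \<le> (\<Sum>i\<in>UNIV. \<Sum>j\<in>UNIV. v i * v j * P i j)"
  shows "\<exists>w. \<forall>i j. P i j = (\<Sum>k\<in>(UNIV :: 'n set). w k i * w k j)"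
  by (rule psd_decomposition_on) (use assms in auto)

text \<open>
  This gives \<open>\<Delta>F \<le> 0\<close> at a maximum of \<open>F\<close>, where the Hessian is negative semidefinite.
\<close>

lemma psd_trace_nonpos:
  fixes P H :: "'n::finite \<Rightarrow> 'n \<Rightarrow> real"
  assumes "\<And>i j. P i j = P j i"
    and "\<And>v. 0 \<le> (\<Sum>i\<in>UNIV. \<Sum>j\<in>UNIV. v i * v j * P i j)"
    and H: "\<And>v. (\<Sum>i\<in>UNIV. \<Sum>j\<in>UNIV. v i * v j * H i j) \<le> 0"
  shows "(\<Sum>i\<in>UNIV. \<Sum>j\<in>UNIV. P i j * H i j) \<le> 0"
proof -
  have "\<exists>w. \<forall>i j. P i j = (\<Sum>k\<in>(UNIV :: 'n set). w k i * w k j)"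
    by (rule psd_decomposition[OF assms(1,2)])
  then obtain w where w: "\<And>i j. P i j = (\<Sum>k\<in>(UNIV :: 'n set). w k i * w k j)" by blast
  have "(\<Sum>i\<in>UNIV. \<Sum>j\<in>UNIV. P i j * H i j) = (\<Sum>i\<in>UNIV. \<Sum>j\<in>UNIV. \<Sum>k\<in>UNIV. w k i * w k j * H i j)"
    by (simp add: w sum_distrib_right)
  also have "\<dots> = (\<Sum>i\<in>UNIV. \<Sum>k\<in>UNIV. \<Sum>j\<in>UNIV. w k i * w k j * H i j)"
    by (rule sum.cong[OF refl], rule sum.swap)
  also have "\<dots> = (\<Sum>k\<in>UNIV. \<Sum>i\<in>UNIV. \<Sum>j\<in>UNIV. w k i * w k j * H i j)"
    by (rule sum.swap)
  also have "\<dots> \<le> 0" by (intro sum_nonpos H)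
  finally show ?thesis .
qed

lemma sum_swap_pairs:
  "(\<Sum>m\<in>A. \<Sum>n\<in>B. \<Sum>j\<in>C. \<Sum>a\<in>D. F m n j a) = (\<Sum>j\<in>C. \<Sum>a\<in>D. \<Sum>m\<in>A. \<Sum>n\<in>B. F m n j a)"
proof -
  have "(\<Sum>m\<in>A. \<Sum>n\<in>B. \<Sum>j\<in>C. \<Sum>a\<in>D. F m n j a) = (\<Sum>m\<in>A. \<Sum>j\<in>C. \<Sum>a\<in>D. \<Sum>n\<in>B. F m n j a)"
    by (intro sum.cong refl) (subst sum.swap, intro sum.cong refl, rule sum.swap)
  also have "\<dots> = (\<Sum>j\<in>C. \<Sum>a\<in>D. \<Sum>m\<in>A. \<Sum>n\<in>B. F m n j a)"
    by (subst sum.swap, intro sum.cong refl, rule sum.swap)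
  finally show ?thesis .
qed

text \<open>
  With the inverse metric for \<open>P\<close> and the Hessian for \<open>H\<close> the sum is \<open>|Hess u|\<^sup>2\<close>: after one factor \<open>P\<close> is
  written as a sum of squares, the other one is evaluated on the vectors \<open>Y k\<close>.
\<close>

lemma psd_square_nonneg:
  fixes P H :: "'n::finite \<Rightarrow> 'n \<Rightarrow> real"
  assumes "\<And>i j. P i j = P j i"
    and "\<And>v. 0 \<le> (\<Sum>i\<in>UNIV. \<Sum>j\<in>UNIV. v i * v j * P i j)"
  shows "0 \<le> (\<Sum>m\<in>UNIV. \<Sum>n\<in>UNIV. \<Sum>j\<in>UNIV. \<Sum>a\<in>UNIV. P m n * (P j a * (H a n * H j m)))"
proof -
  have "\<exists>w. \<forall>i j. P i j = (\<Sum>k\<in>(UNIV :: 'n set). w k i * w k j)"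
    by (rule psd_decomposition[OF assms(1,2)])
  then obtain w where w: "\<And>i j. P i j = (\<Sum>k\<in>(UNIV :: 'n set). w k i * w k j)" by blast
  define Y where "Y k j = (\<Sum>m\<in>UNIV. w k m * H j m)" for k j
  have inner: "(\<Sum>m\<in>UNIV. \<Sum>n\<in>UNIV. P m n * (H a n * H j m)) = (\<Sum>k\<in>UNIV. Y k j * Y k a)" for j a
  proof -
    have "(\<Sum>m\<in>UNIV. \<Sum>n\<in>UNIV. P m n * (H a n * H j m))
        = (\<Sum>m\<in>UNIV. \<Sum>n\<in>UNIV. \<Sum>k\<in>UNIV. (w k m * H j m) * (w k n * H a n))"
      by (simp add: w sum_distrib_left sum_distrib_right mult_ac)
    also have "\<dots> = (\<Sum>m\<in>UNIV. \<Sum>k\<in>UNIV. \<Sum>n\<in>UNIV. (w k m * H j m) * (w k n * H a n))"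
      by (rule sum.cong[OF refl], rule sum.swap)
    also have "\<dots> = (\<Sum>k\<in>UNIV. \<Sum>m\<in>UNIV. \<Sum>n\<in>UNIV. (w k m * H j m) * (w k n * H a n))"
      by (rule sum.swap)
    finally show ?thesis by (simp add: Y_def sum_product)
  qed
  have "(\<Sum>j\<in>UNIV. \<Sum>a\<in>UNIV. P j a * (\<Sum>m\<in>UNIV. \<Sum>n\<in>UNIV. P m n * (H a n * H j m)))
      = (\<Sum>j\<in>UNIV. \<Sum>a\<in>UNIV. P j a * (\<Sum>k\<in>UNIV. Y k j * Y k a))"
    by (simp only: inner)
  also have "\<dots> = (\<Sum>j\<in>UNIV. \<Sum>a\<in>UNIV. \<Sum>k\<in>UNIV. Y k j * Y k a * P j a)"
    by (simp add: sum_distrib_left mult_ac)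
  also have "\<dots> = (\<Sum>j\<in>UNIV. \<Sum>k\<in>UNIV. \<Sum>a\<in>UNIV. Y k j * Y k a * P j a)"
    by (rule sum.cong[OF refl], rule sum.swap)
  also have "\<dots> = (\<Sum>k\<in>UNIV. \<Sum>j\<in>UNIV. \<Sum>a\<in>UNIV. Y k j * Y k a * P j a)"
    by (rule sum.swap)
  also have "\<dots> \<ge> 0" by (intro sum_nonneg assms(2))
  finally have *: "0 \<le> (\<Sum>j\<in>UNIV. \<Sum>a\<in>UNIV. P j a * (\<Sum>m\<in>UNIV. \<Sum>n\<in>UNIV. P m n * (H a n * H j m)))" .
  have "(\<Sum>m\<in>UNIV. \<Sum>n\<in>UNIV. \<Sum>j\<in>UNIV. \<Sum>a\<in>UNIV. P m n * (P j a * (H a n * H j m)))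
      = (\<Sum>j\<in>UNIV. \<Sum>a\<in>UNIV. \<Sum>m\<in>UNIV. \<Sum>n\<in>UNIV. P m n * (P j a * (H a n * H j m)))"
    by (rule sum_swap_pairs)
  also have "\<dots> = (\<Sum>j\<in>UNIV. \<Sum>a\<in>UNIV. P j a * (\<Sum>m\<in>UNIV. \<Sum>n\<in>UNIV. P m n * (H a n * H j m)))"
    by (simp add: sum_distrib_left mult_ac)
  finally show ?thesis using * by simp
qed

lemma matrix_inv_inverse:
  fixes A :: "real^'n^'n::finite"
  assumes "invertible A"
  shows "A ** matrix_inv A = mat 1" "matrix_inv A ** A = mat 1"
  using someI_ex[OF assms[unfolded invertible_def]] unfolding matrix_inv_def by auto

text \<open>
  Cramer's rule, which reduces the regularity of the inverse metric to that of sums, products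
  and quotients.
\<close>

lemma matrix_inv_entry_det:
  fixes A :: "real^'n^'n::finite"
  assumes "invertible A"
  shows "matrix_inv A $ i $ j = det (\<chi> a b. if b = i then of_bool (a = j) else A $ a $ b) / det A"
proof -
  have "A *v (matrix_inv A *v axis j 1) = axis j 1"
    by (simp add: matrix_vector_mul_assoc matrix_inv_inverse assms)
  moreover have "det A \<noteq> 0" using assms invertible_det_nz by blast
  ultimately have eq: "matrix_inv A *v axis j 1 = (\<chi> k. det (\<chi> a b. if b = k then axis j 1 $ a else A $ a $ b) / det A)"
    using cramer by blast
  then have "(matrix_inv A *v axis j 1) $ i = det (\<chi> a b. if b = i then axis j 1 $ a else A $ a $ b) / det A"
    by simp
  moreover have "(\<chi> a b. if b = i then axis j 1 $ a else A $ a $ b) = (\<chi> a b. if b = i then of_bool (a = j) else A $ a $ b)"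
    by (simp add: vec_eq_iff axis_def)
  moreover have "(matrix_inv A *v axis j 1) $ i = matrix_inv A $ i $ j"
    by (simp add: matrix_vector_mul_component inner_axis)
  ultimately show ?thesis by simp
qed

lemma C_k_in_space_det:
  fixes A :: "real \<Rightarrow> real^'n \<Rightarrow> real^'m^'m::finite"
  assumes "open V" "\<And>i j. C_k_in_space k (\<lambda>t y. A t y $ i $ j) I V"
  shows "C_k_in_space k (\<lambda>t y. det (A t y)) I V"
  unfolding det_def
  by (intro C_k_in_space_sum C_k_in_space_mult C_k_in_space_prod C_k_in_space_time assms continuous_on_const)

lemma C_k_in_space_matrix_inv:
  fixes A :: "real \<Rightarrow> real^'n \<Rightarrow> real^'m^'m::finite"
  assumes "open V" "\<And>i j. C_k_in_space k (\<lambda>t y. A t y $ i $ j) I V"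
    and inv: "\<And>t y. t \<in> I \<Longrightarrow> y \<in> V \<Longrightarrow> invertible (A t y)"
  shows "C_k_in_space k (\<lambda>t y. matrix_inv (A t y) $ i $ j) I V"
proof (subst C_k_in_space_cong[OF assms(1)])
  show "matrix_inv (A t y) $ i $ j
      = det (\<chi> a b. if b = i then of_bool (a = j) else A t y $ a $ b) * inverse (det (A t y))"
    if "t \<in> I" "y \<in> V" for t y
    using matrix_inv_entry_det[OF inv[OF that]] by (simp add: field_simps)
  have "C_k_in_space k (\<lambda>t y. (\<chi> a b. if b = i then of_bool (a = j) else A t y $ a $ b) $ c $ d) I V" for c d
    by (cases "d = i") (auto intro!: assms C_k_in_space_time)
  then show "C_k_in_space k (\<lambda>t y. det (\<chi> a b. if b = i then of_bool (a = j) else A t y $ a $ b)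
      * inverse (det (A t y))) I V"
    by (intro C_k_in_space_mult C_k_in_space_inverse C_k_in_space_det assms)
      (use inv invertible_det_nz in blast)+
qed

lemma posdef_invertible:
  fixes A :: "real^'n^'n::finite"
  assumes "\<And>v. v \<noteq> 0 \<Longrightarrow> 0 < v \<bullet> (A *v v)"
  shows "invertible A"
proof -
  have "x = 0" if "A *v x = 0" for x
    using assms[of x] that by (cases "x = 0") auto
  then show ?thesis using matrix_left_invertible_ker[of A] invertible_left_inverse[of A] by blast
qed

text \<open>
  For \<open>x = A\<^sup>-\<^sup>1 v\<close> one has \<open>v \<bullet> A\<^sup>-\<^sup>1 v = A x \<bullet> x\<close>, so positivity passes to the inverse.
\<close>

lemma posdef_matrix_inv:
  fixes A :: "real^'n^'n::finite"
  assumes sym: "transpose A = A" and pos: "\<And>v. v \<noteq> 0 \<Longrightarrow> 0 < v \<bullet> (A *v v)"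
  shows "matrix_inv A $ i $ j = matrix_inv A $ j $ i"
    and "0 \<le> (\<Sum>i\<in>UNIV. \<Sum>j\<in>UNIV. v i * v j * matrix_inv A $ i $ j)"
proof -
  let ?B = "matrix_inv A"
  note inv = matrix_inv_inverse[OF posdef_invertible[OF pos]]
  have "transpose ?B ** A = mat 1"
    using arg_cong[OF inv(1), of transpose] by (simp add: matrix_transpose_mul sym)
  have "transpose ?B = transpose ?B ** (A ** ?B)" by (simp add: inv)
  also have "\<dots> = ?B" by (simp add: matrix_mul_assoc \<open>transpose ?B ** A = mat 1\<close>)
  finally have "transpose ?B = ?B" .
  then show sB: "?B $ i $ j = ?B $ j $ i"
    by (simp add: transpose_def vec_eq_iff)
  let ?v = "\<chi> i. v i"
  have "A *v (?B *v ?v) = ?v" by (simp add: matrix_vector_mul_assoc inv)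
  then have "0 \<le> (?B *v ?v) \<bullet> ?v"
    using pos[of "?B *v ?v"] by (cases "?B *v ?v = 0") auto
  also have "\<dots> = (\<Sum>i\<in>UNIV. \<Sum>j\<in>UNIV. v i * v j * ?B $ i $ j)"
    by (simp add: inner_vec_def matrix_vector_mult_def sum_distrib_left sum_distrib_right mult_ac)
  finally show "0 \<le> (\<Sum>i\<in>UNIV. \<Sum>j\<in>UNIV. v i * v j * ?B $ i $ j)" .
qed

section \<open>Bochner's formula in coordinates\<close>

lemma C_k_in_space_christoffel:
  assumes "open V" "\<And>i j. C_k_in_space (Suc k) (\<lambda>t y. G t y $ i $ j) I V"
    and "\<And>t y. t \<in> I \<Longrightarrow> y \<in> V \<Longrightarrow> invertible (G t y)"
  shows "C_k_in_space k (\<lambda>t. christoffel (G t) c i j) I V"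
  unfolding christoffel_def[abs_def]
  by (intro C_k_in_space_mult C_k_in_space_sum C_k_in_space_add C_k_in_space_diff C_k_in_space_time
      C_k_in_space_partial_deriv C_k_in_space_matrix_inv assms continuous_on_const C_k_in_space_SucD[OF assms(2)])

lemma C_k_in_space_hessian:
  assumes "open V" "\<And>i j. C_k_in_space (Suc k) (\<lambda>t y. G t y $ i $ j) I V"
    and "\<And>t y. t \<in> I \<Longrightarrow> y \<in> V \<Longrightarrow> invertible (G t y)"
    and "C_k_in_space (Suc (Suc k)) w I V"
  shows "C_k_in_space k (\<lambda>t y. hessian_coords (G t) (w t) y $ i $ j) I V"
proof -
  have "C_k_in_space k (\<lambda>t. partial_deriv c (w t)) I V" for c
    using C_k_in_space_SucD[OF assms(4)] by simp
  moreover have "C_k_in_space k (\<lambda>t. partial_deriv c (partial_deriv d (w t))) I V" for c d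
    using assms(4) by simp
  ultimately show ?thesis
    unfolding hessian_coords_def vec_lambda_beta
    by (intro C_k_in_space_mult C_k_in_space_sum C_k_in_space_diff C_k_in_space_christoffel[OF assms(1-3)] assms(1))
qed

lemma C_k_in_space_laplacian:
  assumes "open V" "\<And>i j. C_k_in_space (Suc k) (\<lambda>t y. G t y $ i $ j) I V"
    and "\<And>t y. t \<in> I \<Longrightarrow> y \<in> V \<Longrightarrow> invertible (G t y)"
    and "C_k_in_space (Suc (Suc k)) w I V"
  shows "C_k_in_space k (\<lambda>t. laplacian_coords (G t) (w t)) I V"
  unfolding laplacian_coords_def[abs_def]
  by (intro C_k_in_space_mult C_k_in_space_sum C_k_in_space_matrix_inv
      C_k_in_space_hessian assms C_k_in_space_SucD[OF assms(2)])

text \<open>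
  Lowering the index of the gradient gives back the differential: \<open>G \<nabla>f = df\<close>.
\<close>

lemma grad_norm_formula:
  assumes "invertible (G y)"
  shows "gradient_coords G f y \<bullet> (G y *v gradient_coords G f y)
    = (\<Sum>j\<in>UNIV. \<Sum>i\<in>UNIV. matrix_inv (G y) $ j $ i * (partial_deriv i f y * partial_deriv j f y))"
proof -
  have "G y *v gradient_coords G f y = (\<chi> j. partial_deriv j f y)"
    unfolding gradient_coords_def
    by (simp add: matrix_vector_mul_assoc matrix_inv_inverse[OF assms])
  then have "gradient_coords G f y \<bullet> (G y *v gradient_coords G f y)
      = gradient_coords G f y \<bullet> (\<chi> j. partial_deriv j f y)" by simp
  then show ?thesis
    by (simp add: inner_vec_def gradient_coords_def matrix_vector_mult_def sum_distrib_left sum_distrib_right mult_ac)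
qed

lemma C_k_in_space_grad_norm:
  assumes "open V" "\<And>i j. C_k_in_space k (\<lambda>t y. G t y $ i $ j) I V"
    and inv: "\<And>t y. t \<in> I \<Longrightarrow> y \<in> V \<Longrightarrow> invertible (G t y)"
    and "C_k_in_space (Suc k) w I V"
  shows "C_k_in_space k (\<lambda>t y. gradient_coords (G t) (w t) y \<bullet> (G t y *v gradient_coords (G t) (w t) y)) I V"
proof (subst C_k_in_space_cong[OF assms(1)])
  show "gradient_coords (G t) (w t) y \<bullet> (G t y *v gradient_coords (G t) (w t) y)
    = (\<Sum>j\<in>UNIV. \<Sum>i\<in>UNIV. matrix_inv (G t y) $ j $ i * (partial_deriv i (w t) y * partial_deriv j (w t) y))"
    if "t \<in> I" "y \<in> V" for t y by (rule grad_norm_formula[where G = "G t" and y = y and f = "w t", OF inv[OF that]])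
  have "C_k_in_space k (\<lambda>t. partial_deriv i (w t)) I V" for i using assms(4) by simp
  then show "C_k_in_space k (\<lambda>t y. \<Sum>j\<in>UNIV. \<Sum>i\<in>UNIV. matrix_inv (G t y) $ j $ i
      * (partial_deriv i (w t) y * partial_deriv j (w t) y)) I V"
    by (intro C_k_in_space_sum C_k_in_space_mult C_k_in_space_matrix_inv assms)
qed

text \<open>
  A Riemannian metric at one time, in the image \<open>V\<close> of one chart.  Class \<open>C\<^sup>2\<close> is what the curvature
  requires.
\<close>

locale coord_metric =
  fixes V :: "(real^'n::finite) set" and G :: "real^'n \<Rightarrow> real^'n^'n"
  assumes open_V: "open V"
    and smooth_G: "\<And>i j. C_k_in_space 2 (\<lambda>_ y. G y $ i $ j) {0} V"
    and sym_G: "\<And>y. y \<in> V \<Longrightarrow> transpose (G y) = G y"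
    and pos_G: "\<And>y v. y \<in> V \<Longrightarrow> v \<noteq> 0 \<Longrightarrow> 0 < v \<bullet> (G y *v v)"
begin

definition ginv :: "'n \<Rightarrow> 'n \<Rightarrow> real^'n \<Rightarrow> real" where
  "ginv i j y = matrix_inv (G y) $ i $ j"

abbreviation \<Gamma> :: "'n \<Rightarrow> 'n \<Rightarrow> 'n \<Rightarrow> real^'n \<Rightarrow> real" where
  "\<Gamma> \<equiv> christoffel G"

abbreviation ck :: "nat \<Rightarrow> (real^'n \<Rightarrow> real) \<Rightarrow> bool" where
  "ck k f \<equiv> C_k_in_space k (\<lambda>_. f) {0} V"

lemma invertible_G: "y \<in> V \<Longrightarrow> invertible (G y)"
  using pos_G by (intro posdef_invertible) auto

lemma ginv_sym: "y \<in> V \<Longrightarrow> ginv i j y = ginv j i y"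
  unfolding ginv_def using posdef_matrix_inv(1)[of "G y"] sym_G pos_G by auto

lemma ginv_psd: "y \<in> V \<Longrightarrow> 0 \<le> (\<Sum>i\<in>UNIV. \<Sum>j\<in>UNIV. v i * v j * ginv i j y)"
  unfolding ginv_def using posdef_matrix_inv(2)[of "G y"] sym_G pos_G by auto

lemma ck_ginv: "ck 2 (ginv i j)"
  using C_k_in_space_matrix_inv[OF open_V, of 2 "\<lambda>_. G" "{0}"] smooth_G invertible_G
  by (simp add: ginv_def[abs_def])

lemma ck_\<Gamma>: "ck 1 (\<Gamma> k i j)"
  using C_k_in_space_christoffel[OF open_V, of 1 "\<lambda>_. G" "{0}"] smooth_G invertible_G
  by (simp only: numeral_2_eq_2 One_nat_def)

lemma differentiable [simp]:
  assumes "y \<in> V"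
  shows "(\<lambda>z. G z $ i $ j) differentiable at y" "ginv i j differentiable at y"
    "partial_deriv m (ginv i j) differentiable at y" "\<Gamma> k i j differentiable at y"
  using smooth_G[of i j] ck_ginv[of i j] ck_\<Gamma>[of k i j] assms by (auto simp: numeral_2_eq_2)

lemma ginv_G: "y \<in> V \<Longrightarrow> (\<Sum>a\<in>UNIV. ginv i a y * G y $ a $ b) = of_bool (i = b)"
  using arg_cong[OF matrix_inv_inverse(2)[OF invertible_G], of y "\<lambda>A. A $ i $ b"]
  by (simp add: matrix_matrix_mult_def ginv_def mat_def)

lemma G_ginv: "y \<in> V \<Longrightarrow> (\<Sum>b\<in>UNIV. G y $ a $ b * ginv b j y) = of_bool (a = j)"
  using arg_cong[OF matrix_inv_inverse(1)[OF invertible_G], of y "\<lambda>A. A $ a $ j"]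
  by (simp add: matrix_matrix_mult_def ginv_def mat_def)

text \<open>
  The derivative of \<open>G\<^sup>-\<^sup>1 G = 1\<close>, solved for the derivative of \<open>G\<^sup>-\<^sup>1\<close>.
\<close>

lemma partial_deriv_ginv:
  assumes y: "y \<in> V"
  shows "partial_deriv m (ginv i j) y
    = - (\<Sum>a\<in>UNIV. \<Sum>b\<in>UNIV. ginv i a y * partial_deriv m (\<lambda>z. G z $ a $ b) y * ginv b j y)"
proof -
  let ?D = "\<lambda>a b. partial_deriv m (\<lambda>z. G z $ a $ b) y" and ?q = "\<lambda>a. partial_deriv m (ginv i a) y"
  have zero: "(\<Sum>a\<in>UNIV. ginv i a y * ?D a b + ?q a * G y $ a $ b) = 0" for b
  proof -
    have "partial_deriv m (\<lambda>z. \<Sum>a\<in>UNIV. ginv i a z * G z $ a $ b) y = partial_deriv m (\<lambda>_. of_bool (i = b)) y"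
      by (rule partial_deriv_cong[OF open_V y]) (rule ginv_G)
    then show ?thesis using y by (simp add: partial_deriv_sum partial_deriv_mult)
  qed
  have "0 = (\<Sum>b\<in>UNIV. (\<Sum>a\<in>UNIV. ginv i a y * ?D a b + ?q a * G y $ a $ b) * ginv b j y)"
    by (simp add: zero)
  also have "\<dots> = (\<Sum>b\<in>UNIV. \<Sum>a\<in>UNIV. ginv i a y * ?D a b * ginv b j y) + (\<Sum>b\<in>UNIV. \<Sum>a\<in>UNIV. ?q a * (G y $ a $ b * ginv b j y))"
    by (simp add: sum_distrib_left sum_distrib_right sum.distrib algebra_simps)
  also have "(\<Sum>b\<in>UNIV. \<Sum>a\<in>UNIV. ?q a * (G y $ a $ b * ginv b j y)) = (\<Sum>a\<in>UNIV. ?q a * (\<Sum>b\<in>UNIV. G y $ a $ b * ginv b j y))"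
    by (subst sum.swap) (simp add: sum_distrib_left)
  also have "\<dots> = ?q j" by (simp add: G_ginv y)
  also have "(\<Sum>b\<in>UNIV. \<Sum>a\<in>UNIV. ginv i a y * ?D a b * ginv b j y) = (\<Sum>a\<in>UNIV. \<Sum>b\<in>UNIV. ginv i a y * ?D a b * ginv b j y)"
    by (rule sum.swap)
  finally show ?thesis by simp
qed

lemma partial_G_sym: "y \<in> V \<Longrightarrow> partial_deriv m (\<lambda>z. G z $ a $ b) y = partial_deriv m (\<lambda>z. G z $ b $ a) y"
  by (rule partial_deriv_cong[OF open_V]) (use sym_G in \<open>auto simp: transpose_def vec_eq_iff\<close>)

lemma \<Gamma>_sym: "y \<in> V \<Longrightarrow> \<Gamma> k i j y = \<Gamma> k j i y"
  unfolding christoffel_def by (simp add: partial_G_sym[of y _ i j] add.commute)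

text \<open>
  The inverse metric is parallel: \<open>\<nabla>\<^sub>m g\<^sup>i\<^sup>j = 0\<close>.  In the sum of the two Christoffel terms, after the
  summation indices of the second are exchanged, the derivatives \<open>\<partial>\<^sub>k g\<^sub>m\<^sub>l - \<partial>\<^sub>l g\<^sub>m\<^sub>k\<close> cancel and \<open>\<partial>\<^sub>m g\<^sub>k\<^sub>l\<close> remains
  twice.
\<close>

lemma metric_compat:
  assumes y: "y \<in> V"
  shows "partial_deriv m (ginv i j) y = - (\<Sum>k\<in>UNIV. \<Gamma> i m k y * ginv k j y) - (\<Sum>k\<in>UNIV. \<Gamma> j m k y * ginv k i y)"
proof -
  let ?D = "\<lambda>c a b. partial_deriv c (\<lambda>z. G z $ a $ b) y"
  have Ds: "?D c a b = ?D c b a" for c a b by (rule partial_G_sym[OF y])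
  have e: "(\<Sum>k\<in>UNIV. \<Gamma> i m k y * ginv k j y)
      = (\<Sum>k\<in>UNIV. \<Sum>l\<in>UNIV. (1/2) * (ginv i l y * ginv k j y * (?D m k l + ?D k m l - ?D l m k)))" for i j
    by (simp add: christoffel_def ginv_def sum_distrib_left sum_distrib_right mult_ac)
  have "(\<Sum>k\<in>UNIV. \<Gamma> j m k y * ginv k i y)
      = (\<Sum>l\<in>UNIV. \<Sum>k\<in>UNIV. (1/2) * (ginv j k y * ginv l i y * (?D m l k + ?D l m k - ?D k m l)))"
    by (rule e)
  also have "\<dots> = (\<Sum>k\<in>UNIV. \<Sum>l\<in>UNIV. (1/2) * (ginv j k y * ginv l i y * (?D m l k + ?D l m k - ?D k m l)))"
    by (rule sum.swap)
  finally have "(\<Sum>k\<in>UNIV. \<Gamma> i m k y * ginv k j y) + (\<Sum>k\<in>UNIV. \<Gamma> j m k y * ginv k i y)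
      = (\<Sum>k\<in>UNIV. \<Sum>l\<in>UNIV. (1/2) * (ginv i l y * ginv k j y * (?D m k l + ?D k m l - ?D l m k))
          + (1/2) * (ginv j k y * ginv l i y * (?D m l k + ?D l m k - ?D k m l)))"
    by (simp only: e sum.distrib)
  also have "\<dots> = (\<Sum>k\<in>UNIV. \<Sum>l\<in>UNIV. ginv i l y * ?D m l k * ginv k j y)"
  proof (intro sum.cong refl)
    fix k l
    show "(1/2) * (ginv i l y * ginv k j y * (?D m k l + ?D k m l - ?D l m k))
          + (1/2) * (ginv j k y * ginv l i y * (?D m l k + ?D l m k - ?D k m l)) = ginv i l y * ?D m l k * ginv k j y"
      using ginv_sym[OF y, of j k] ginv_sym[OF y, of l i] Ds[of m k l] by (simp add: algebra_simps)
  qed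
  also have "\<dots> = - partial_deriv m (ginv i j) y"
    by (subst sum.swap) (simp add: partial_deriv_ginv[OF y])
  finally show ?thesis by simp
qed

text \<open>
  The endomorphism \<open>R(\<partial>\<^sub>n, \<partial>\<^sub>m)\<close> is skew with respect to the metric.  This is the integrability
  condition of \<open>\<nabla>g\<^sup>-\<^sup>1 = 0\<close>: differentiating \<open>metric_compat\<close> once more and antisymmetrising in the two derivatives kills the second derivatives of the inverse metric and the
  terms \<open>C\<close>, and leaves \<open>R\<^sup>i\<^sub>n\<^sub>m\<^sub>k g\<^sup>k\<^sup>j + R\<^sup>j\<^sub>n\<^sub>m\<^sub>k g\<^sup>k\<^sup>i = 0\<close>.
\<close>

lemma riemann_raised_antisym:
  assumes y: "y \<in> V"
  shows "(\<Sum>k\<in>UNIV. riemann G i n m k y * ginv k j y) = - (\<Sum>k\<in>UNIV. riemann G j n m k y * ginv k i y)"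
proof -
  define B where "B n m i j = (\<Sum>k\<in>UNIV. \<Sum>q\<in>UNIV. \<Gamma> i m k y * \<Gamma> k n q y * ginv q j y)" for n m i j
  define C where "C n m i j = (\<Sum>k\<in>UNIV. \<Sum>q\<in>UNIV. \<Gamma> i m k y * \<Gamma> j n q y * ginv q k y)" for n m i j
  define E where "E n m i j = (\<Sum>k\<in>UNIV. partial_deriv n (\<Gamma> i m k) y * ginv k j y)" for n m i j
  have C_sym: "C n m i j = C m n j i" for n m i j
    unfolding C_def by (subst sum.swap) (simp add: ginv_sym[OF y] mult_ac)
  have second: "partial_deriv n (partial_deriv m (ginv i j)) y
      = B n m i j + C n m i j - E n m i j + B n m j i + C n m j i - E n m j i" for n m i j
  proof -
    have one: "partial_deriv n (\<lambda>z. \<Sum>k\<in>UNIV. \<Gamma> i m k z * ginv k j z) y = E n m i j - B n m i j - C n m i j" for i j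
    proof -
      have "partial_deriv n (\<lambda>z. \<Sum>k\<in>UNIV. \<Gamma> i m k z * ginv k j z) y
        = (\<Sum>k\<in>UNIV. \<Gamma> i m k y * partial_deriv n (ginv k j) y + partial_deriv n (\<Gamma> i m k) y * ginv k j y)"
        using y by (simp add: partial_deriv_sum partial_deriv_mult)
      also have "\<dots> = E n m i j - B n m i j - C n m i j"
        unfolding metric_compat[OF y] E_def B_def C_def
        by (simp add: sum_distrib_left sum.distrib sum_subtractf sum_negf algebra_simps)
      finally show ?thesis .
    qed
    have "partial_deriv n (partial_deriv m (ginv i j)) y
      = partial_deriv n (\<lambda>z. (-1) * (\<Sum>k\<in>UNIV. \<Gamma> i m k z * ginv k j z) - (\<Sum>k\<in>UNIV. \<Gamma> j m k z * ginv k i z)) y"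
      by (rule partial_deriv_cong[OF open_V y]) (simp add: metric_compat)
    also have "\<dots> = - partial_deriv n (\<lambda>z. \<Sum>k\<in>UNIV. \<Gamma> i m k z * ginv k j z) y
        - partial_deriv n (\<lambda>z. \<Sum>k\<in>UNIV. \<Gamma> j m k z * ginv k i z) y"
      using y by (subst partial_deriv_diff; (subst partial_deriv_cmult)?) auto
    finally show ?thesis by (simp add: one)
  qed
  have commute: "partial_deriv n (partial_deriv m (ginv i j)) y = partial_deriv m (partial_deriv n (ginv i j)) y"
    by (rule partial_deriv_commute[OF open_V y ck_ginv])
  have R: "(\<Sum>k\<in>UNIV. riemann G i n m k y * ginv k j y) = E n m i j - E m n i j + B m n i j - B n m i j" for i j
  proof -
    have "(\<Sum>k\<in>UNIV. riemann G i n m k y * ginv k j y) = E n m i j - E m n i j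
        + (\<Sum>k\<in>UNIV. \<Sum>q\<in>UNIV. \<Gamma> i n q y * \<Gamma> q m k y * ginv k j y)
        - (\<Sum>k\<in>UNIV. \<Sum>q\<in>UNIV. \<Gamma> i m q y * \<Gamma> q n k y * ginv k j y)"
      unfolding riemann_def E_def
      by (simp add: sum_distrib_left sum_distrib_right sum.distrib sum_subtractf algebra_simps)
    also have "(\<Sum>k\<in>UNIV. \<Sum>q\<in>UNIV. \<Gamma> i n q y * \<Gamma> q m k y * ginv k j y) = B m n i j"
      unfolding B_def by (rule sum.swap)
    also have "(\<Sum>k\<in>UNIV. \<Sum>q\<in>UNIV. \<Gamma> i m q y * \<Gamma> q n k y * ginv k j y) = B n m i j"
      unfolding B_def by (rule sum.swap)
    finally show ?thesis .
  qed
  show ?thesis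
    using commute[unfolded second] C_sym[of n m i j] C_sym[of n m j i] by (simp add: R)
qed

text \<open>
  Bochner's formula produces the contraction of the curvature over the indices \<open>m, n\<close>;
  antisymmetry moves the raised index to the slot over which the Ricci tensor is defined as a trace.
\<close>

lemma ricci_contraction:
  assumes y: "y \<in> V"
  shows "(\<Sum>m\<in>UNIV. \<Sum>n\<in>UNIV. ginv m n y * riemann G l n j m y) = - (\<Sum>m\<in>UNIV. ricci_coords G y $ j $ m * ginv m l y)"
proof -
  have "(\<Sum>m\<in>UNIV. \<Sum>n\<in>UNIV. ginv m n y * riemann G l n j m y) = (\<Sum>n\<in>UNIV. \<Sum>m\<in>UNIV. riemann G l n j m y * ginv m n y)"
    by (subst sum.swap) (simp add: mult.commute)
  also have "\<dots> = - (\<Sum>n\<in>UNIV. \<Sum>m\<in>UNIV. riemann G n n j m y * ginv m l y)"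
    by (simp only: riemann_raised_antisym[OF y, of l _ j] sum_negf)
  also have "(\<Sum>n\<in>UNIV. \<Sum>m\<in>UNIV. riemann G n n j m y * ginv m l y) = (\<Sum>m\<in>UNIV. \<Sum>n\<in>UNIV. riemann G n n j m y * ginv m l y)"
    by (rule sum.swap)
  finally show ?thesis by (simp add: ricci_coords_def sum_distrib_right)
qed

end

text \<open>
  Bochner's formula contains the gradient of \<open>\<Delta>f\<close>, hence class \<open>C\<^sup>3\<close>.
\<close>

locale coord_function = coord_metric V G
  for V :: "(real^'n::finite) set" and G +
  fixes f :: "real^'n \<Rightarrow> real"
  assumes smooth_f: "C_k_in_space 3 (\<lambda>_. f) {0} V"
begin

abbreviation df :: "'n \<Rightarrow> real^'n \<Rightarrow> real" where
  "df i \<equiv> partial_deriv i f"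

definition grad :: "'n \<Rightarrow> real^'n \<Rightarrow> real" where
  "grad j y = (\<Sum>i\<in>UNIV. ginv j i y * df i y)"

definition Hess :: "'n \<Rightarrow> 'n \<Rightarrow> real^'n \<Rightarrow> real" where
  "Hess i j y = partial_deriv i (df j) y - (\<Sum>k\<in>UNIV. \<Gamma> k i j y * df k y)"

definition grad_sq :: "real^'n \<Rightarrow> real" where
  "grad_sq y = (\<Sum>j\<in>UNIV. df j y * grad j y)"

text \<open>
  The covariant derivative \<open>(\<nabla>\<^sub>n Hess f)\<^sub>j\<^sub>m\<close>.
\<close>

definition DHess :: "'n \<Rightarrow> 'n \<Rightarrow> 'n \<Rightarrow> real^'n \<Rightarrow> real" where
  "DHess n j m y = partial_deriv n (Hess j m) y
     - (\<Sum>k\<in>UNIV. \<Gamma> k n j y * Hess k m y) - (\<Sum>k\<in>UNIV. \<Gamma> k n m y * Hess j k y)"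

lemma hessian_Hess: "hessian_coords G f y $ i $ j = Hess i j y"
  by (simp add: hessian_coords_def Hess_def)

lemma laplacian_Hess: "laplacian_coords G f y = (\<Sum>i\<in>UNIV. \<Sum>j\<in>UNIV. ginv i j y * Hess i j y)"
  by (simp add: laplacian_coords_def hessian_Hess ginv_def)

lemma ck_df: "ck 2 (df i)"
  using smooth_f by (simp add: numeral_3_eq_3 numeral_2_eq_2)

lemma ck_grad: "ck 2 (grad i)"
  unfolding grad_def[abs_def] by (intro C_k_in_space_sum C_k_in_space_mult ck_ginv ck_df open_V)

lemma ck_Hess: "ck 1 (Hess i j)"
  unfolding Hess_def[abs_def]
  using ck_df
  by (intro C_k_in_space_diff C_k_in_space_sum C_k_in_space_mult ck_\<Gamma> open_V C_k_in_space_le[OF ck_df])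
    (auto simp: numeral_2_eq_2)

lemma ck_grad_sq: "ck 2 grad_sq"
  unfolding grad_sq_def[abs_def] by (intro C_k_in_space_sum C_k_in_space_mult ck_df ck_grad open_V)

lemma differentiable_f [simp]:
  assumes "y \<in> V"
  shows "df i differentiable at y" "partial_deriv j (df i) differentiable at y"
    "grad i differentiable at y" "Hess i j differentiable at y"
  using ck_df[of i] ck_grad[of i] ck_Hess[of i j] assms by (auto simp: numeral_2_eq_2)

lemma ddf_eq: "partial_deriv i (df j) y = Hess i j y + (\<Sum>k\<in>UNIV. \<Gamma> k i j y * df k y)"
  by (simp add: Hess_def)

lemma Hess_sym: "y \<in> V \<Longrightarrow> Hess i j y = Hess j i y"
  unfolding Hess_def
  using partial_deriv_commute[OF open_V _ C_k_in_space_le[OF smooth_f], of y i j] \<Gamma>_sym[of y _ i j]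
  by simp

text \<open>
  The covariant derivative of the gradient field is the Hessian with an index raised.
\<close>

lemma partial_deriv_grad:
  assumes y: "y \<in> V"
  shows "partial_deriv m (grad i) y = (\<Sum>j\<in>UNIV. ginv i j y * Hess j m y) - (\<Sum>k\<in>UNIV. \<Gamma> i m k y * grad k y)"
proof -
  have "partial_deriv m (grad i) y
      = (\<Sum>j\<in>UNIV. ginv i j y * partial_deriv m (df j) y + partial_deriv m (ginv i j) y * df j y)"
    unfolding grad_def[abs_def] using y by (simp add: partial_deriv_sum partial_deriv_mult)
  also have "\<dots> = (\<Sum>j\<in>UNIV. ginv i j y * Hess m j y)
      + (\<Sum>j\<in>UNIV. \<Sum>k\<in>UNIV. ginv i j y * \<Gamma> k m j y * df k y)
      - (\<Sum>j\<in>UNIV. \<Sum>k\<in>UNIV. \<Gamma> i m k y * ginv k j y * df j y)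
      - (\<Sum>j\<in>UNIV. \<Sum>k\<in>UNIV. \<Gamma> j m k y * ginv k i y * df j y)"
    unfolding metric_compat[OF y] ddf_eq
    by (simp add: sum_distrib_left sum_distrib_right sum.distrib sum_subtractf sum_negf algebra_simps)
  also have "(\<Sum>j\<in>UNIV. \<Sum>k\<in>UNIV. ginv i j y * \<Gamma> k m j y * df k y)
      = (\<Sum>j\<in>UNIV. \<Sum>k\<in>UNIV. \<Gamma> j m k y * ginv k i y * df j y)"
    by (subst sum.swap) (simp add: ginv_sym[OF y, of i] mult_ac)
  also have "(\<Sum>j\<in>UNIV. \<Sum>k\<in>UNIV. \<Gamma> i m k y * ginv k j y * df j y) = (\<Sum>k\<in>UNIV. \<Gamma> i m k y * grad k y)"
    by (subst sum.swap) (simp add: grad_def sum_distrib_left mult_ac)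
  finally show ?thesis by (simp add: Hess_sym[OF y, of m])
qed

lemma partial_deriv_grad_sq:
  assumes y: "y \<in> V"
  shows "partial_deriv m grad_sq y = 2 * (\<Sum>j\<in>UNIV. grad j y * Hess j m y)"
proof -
  have "partial_deriv m grad_sq y
      = (\<Sum>j\<in>UNIV. df j y * partial_deriv m (grad j) y + partial_deriv m (df j) y * grad j y)"
    unfolding grad_sq_def[abs_def] using y by (simp add: partial_deriv_sum partial_deriv_mult)
  also have "\<dots> = (\<Sum>j\<in>UNIV. \<Sum>a\<in>UNIV. df j y * ginv j a y * Hess a m y)
      - (\<Sum>j\<in>UNIV. \<Sum>k\<in>UNIV. df j y * \<Gamma> j m k y * grad k y)
      + (\<Sum>j\<in>UNIV. grad j y * Hess m j y)
      + (\<Sum>j\<in>UNIV. \<Sum>k\<in>UNIV. \<Gamma> k m j y * df k y * grad j y)"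
    unfolding partial_deriv_grad[OF y] ddf_eq
    by (simp add: sum_distrib_left sum_distrib_right sum.distrib sum_subtractf algebra_simps)
  also have "(\<Sum>j\<in>UNIV. \<Sum>k\<in>UNIV. df j y * \<Gamma> j m k y * grad k y)
      = (\<Sum>j\<in>UNIV. \<Sum>k\<in>UNIV. \<Gamma> k m j y * df k y * grad j y)"
    by (subst sum.swap) (simp add: mult_ac)
  also have "(\<Sum>j\<in>UNIV. \<Sum>a\<in>UNIV. df j y * ginv j a y * Hess a m y) = (\<Sum>a\<in>UNIV. grad a y * Hess a m y)"
    by (subst sum.swap) (simp add: grad_def sum_distrib_left sum_distrib_right ginv_sym[OF y] mult_ac)
  finally show ?thesis by (simp add: Hess_sym[OF y, of m])
qed

text \<open>
  Third covariant derivatives commute up to curvature.  With \<open>\<partial>\<^sub>n \<partial>\<^sub>j \<partial>\<^sub>m f\<close> symmetric, and the terms of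
  first order in the Hessian matching by symmetry of \<open>\<Gamma>\<close> and of the Hessian, only the
  terms that multiply \<open>df\<close> survive, and these are the components of the curvature.
\<close>

lemma ricci_identity:
  assumes y: "y \<in> V"
  shows "DHess n j m y = DHess j n m y - (\<Sum>l\<in>UNIV. riemann G l n j m y * df l y)"
proof -
  have dH: "partial_deriv n (Hess j m) y = partial_deriv n (partial_deriv j (df m)) y
      - (\<Sum>k\<in>UNIV. partial_deriv n (\<Gamma> k j m) y * df k y) - (\<Sum>k\<in>UNIV. \<Gamma> k j m y * Hess n k y)
      - (\<Sum>k\<in>UNIV. \<Sum>l\<in>UNIV. \<Gamma> k j m y * (\<Gamma> l n k y * df l y))" for n j m
  proof -
    have "partial_deriv n (Hess j m) y = partial_deriv n (partial_deriv j (df m)) y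
      - (\<Sum>k\<in>UNIV. \<Gamma> k j m y * partial_deriv n (df k) y + partial_deriv n (\<Gamma> k j m) y * df k y)"
      unfolding Hess_def[abs_def] using y
      by (simp add: partial_deriv_diff partial_deriv_sum partial_deriv_mult differentiable_sum differentiable_mult)
    then show ?thesis
      unfolding ddf_eq
      by (simp add: sum_distrib_left sum.distrib algebra_simps)
  qed
  have commute: "partial_deriv n (partial_deriv j (df m)) y = partial_deriv j (partial_deriv n (df m)) y"
    by (rule partial_deriv_commute[OF open_V y ck_df])
  have R: "(\<Sum>l\<in>UNIV. riemann G l n j m y * df l y)
      = (\<Sum>k\<in>UNIV. partial_deriv n (\<Gamma> k j m) y * df k y) - (\<Sum>k\<in>UNIV. partial_deriv j (\<Gamma> k n m) y * df k y)
       + (\<Sum>k\<in>UNIV. \<Sum>l\<in>UNIV. \<Gamma> k j m y * (\<Gamma> l n k y * df l y))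
       - (\<Sum>k\<in>UNIV. \<Sum>l\<in>UNIV. \<Gamma> k n m y * (\<Gamma> l j k y * df l y))"
  proof -
    have "(\<Sum>l\<in>UNIV. riemann G l n j m y * df l y)
      = (\<Sum>k\<in>UNIV. partial_deriv n (\<Gamma> k j m) y * df k y) - (\<Sum>k\<in>UNIV. partial_deriv j (\<Gamma> k n m) y * df k y)
       + (\<Sum>l\<in>UNIV. \<Sum>k\<in>UNIV. \<Gamma> k j m y * (\<Gamma> l n k y * df l y))
       - (\<Sum>l\<in>UNIV. \<Sum>k\<in>UNIV. \<Gamma> k n m y * (\<Gamma> l j k y * df l y))"
      unfolding riemann_def
      by (simp add: sum_distrib_left sum_distrib_right sum.distrib sum_subtractf algebra_simps)
    moreover note sum.swap[of "\<lambda>l k. \<Gamma> k j m y * (\<Gamma> l n k y * df l y)" UNIV UNIV]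
      sum.swap[of "\<lambda>l k. \<Gamma> k n m y * (\<Gamma> l j k y * df l y)" UNIV UNIV]
    ultimately show ?thesis by simp
  qed
  have \<Gamma>s: "\<Gamma> k n j y = \<Gamma> k j n y" for k by (rule \<Gamma>_sym[OF y])
  have Hs: "Hess n k y = Hess k n y" "Hess j k y = Hess k j y" for k by (rule Hess_sym[OF y])+
  show ?thesis
    unfolding DHess_def R dH commute by (simp add: \<Gamma>s Hs)
qed

text \<open>
  The trace commutes with covariant differentiation because the inverse metric is parallel.
\<close>

lemma partial_deriv_laplacian:
  assumes y: "y \<in> V"
  shows "partial_deriv j (laplacian_coords G f) y = (\<Sum>m\<in>UNIV. \<Sum>n\<in>UNIV. ginv m n y * DHess j m n y)"
proof -
  have "partial_deriv j (laplacian_coords G f) y = partial_deriv j (\<lambda>z. \<Sum>m\<in>UNIV. \<Sum>n\<in>UNIV. ginv m n z * Hess m n z) y"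
    by (simp add: laplacian_Hess cong: partial_deriv_cong[OF open_V y])
  also have "\<dots> = (\<Sum>m\<in>UNIV. \<Sum>n\<in>UNIV. ginv m n y * partial_deriv j (Hess m n) y + partial_deriv j (ginv m n) y * Hess m n y)"
    using y by (simp add: partial_deriv_sum partial_deriv_mult differentiable_sum differentiable_mult)
  also have "\<dots> = (\<Sum>m\<in>UNIV. \<Sum>n\<in>UNIV. ginv m n y * partial_deriv j (Hess m n) y)
     - (\<Sum>m\<in>UNIV. \<Sum>n\<in>UNIV. \<Sum>k\<in>UNIV. \<Gamma> m j k y * ginv k n y * Hess m n y)
     - (\<Sum>m\<in>UNIV. \<Sum>n\<in>UNIV. \<Sum>k\<in>UNIV. \<Gamma> n j k y * ginv k m y * Hess m n y)"
    unfolding metric_compat[OF y]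
    by (simp add: sum_distrib_left sum_distrib_right sum.distrib sum_subtractf sum_negf algebra_simps)
  also have "(\<Sum>m\<in>UNIV. \<Sum>n\<in>UNIV. \<Sum>k\<in>UNIV. \<Gamma> m j k y * ginv k n y * Hess m n y)
     = (\<Sum>m\<in>UNIV. \<Sum>n\<in>UNIV. \<Sum>k\<in>UNIV. ginv m n y * (\<Gamma> k j m y * Hess k n y))"
  proof -
    have "(\<Sum>m\<in>UNIV. \<Sum>n\<in>UNIV. \<Sum>k\<in>UNIV. \<Gamma> m j k y * ginv k n y * Hess m n y)
      = (\<Sum>n\<in>UNIV. \<Sum>m\<in>UNIV. \<Sum>k\<in>UNIV. \<Gamma> m j k y * ginv k n y * Hess m n y)"
      by (rule sum.swap)
    also have "\<dots> = (\<Sum>n\<in>UNIV. \<Sum>m\<in>UNIV. \<Sum>k\<in>UNIV. ginv m n y * (\<Gamma> k j m y * Hess k n y))"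
      by (rule sum.cong[OF refl], subst sum.swap) (simp add: mult_ac)
    finally show ?thesis by (subst sum.swap)
  qed
  also have "(\<Sum>m\<in>UNIV. \<Sum>n\<in>UNIV. \<Sum>k\<in>UNIV. \<Gamma> n j k y * ginv k m y * Hess m n y)
     = (\<Sum>m\<in>UNIV. \<Sum>n\<in>UNIV. \<Sum>k\<in>UNIV. ginv m n y * (\<Gamma> k j n y * Hess m k y))"
    by (rule sum.cong[OF refl], subst sum.swap) (simp add: ginv_sym[OF y] mult_ac)
  finally show ?thesis
    unfolding DHess_def by (simp add: sum_distrib_left sum.distrib sum_subtractf algebra_simps)
qed

text \<open>
  Since \<open>\<partial>\<^sub>m |\<nabla>f|\<^sup>2 = 2 \<langle>\<nabla>f, \<nabla>\<^sub>m \<nabla>f\<rangle>\<close>, the Hessian of \<open>|\<nabla>f|\<^sup>2\<close> is twice the square of \<open>Hess f\<close> plus twice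
  \<open>\<nabla>f\<close> paired with \<open>\<nabla>Hess f\<close>.  The trace of the second summand is rewritten with \<open>ricci_identity\<close>, so that the
  derivative falls on \<open>\<Delta>f\<close>, at the price of a curvature contraction that \<open>ricci_contraction\<close> evaluates.
\<close>

lemma bochner_formula:
  assumes y: "y \<in> V"
  shows "laplacian_coords G grad_sq y
    = 2 * (\<Sum>m\<in>UNIV. \<Sum>n\<in>UNIV. \<Sum>j\<in>UNIV. \<Sum>a\<in>UNIV. ginv m n y * (ginv j a y * (Hess a n y * Hess j m y)))
      + 2 * (\<Sum>j\<in>UNIV. grad j y * partial_deriv j (laplacian_coords G f) y)
      + 2 * (\<Sum>j\<in>UNIV. \<Sum>m\<in>UNIV. grad j y * grad m y * ricci_coords G y $ j $ m)"
proof -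
  have hess: "hessian_coords G grad_sq y $ n $ m
      = 2 * (\<Sum>j\<in>UNIV. \<Sum>a\<in>UNIV. ginv j a y * (Hess a n y * Hess j m y)) + 2 * (\<Sum>j\<in>UNIV. grad j y * DHess n j m y)" for n m
  proof -
    have "partial_deriv n (partial_deriv m grad_sq) y = partial_deriv n (\<lambda>z. 2 * (\<Sum>j\<in>UNIV. grad j z * Hess j m z)) y"
      by (rule partial_deriv_cong[OF open_V y]) (simp add: partial_deriv_grad_sq)
    also have "\<dots> = 2 * (\<Sum>j\<in>UNIV. grad j y * partial_deriv n (Hess j m) y + partial_deriv n (grad j) y * Hess j m y)"
      using y by (simp add: partial_deriv_cmult partial_deriv_sum partial_deriv_mult differentiable_sum differentiable_mult)
    finally have 1: "hessian_coords G grad_sq y $ n $ m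
      = 2 * (\<Sum>j\<in>UNIV. grad j y * partial_deriv n (Hess j m) y + partial_deriv n (grad j) y * Hess j m y)
       - (\<Sum>k\<in>UNIV. \<Gamma> k n m y * (2 * (\<Sum>j\<in>UNIV. grad j y * Hess j k y)))"
      by (simp add: hessian_coords_def partial_deriv_grad_sq[OF y])
    have 2: "(\<Sum>k\<in>UNIV. \<Gamma> k n m y * (2 * (\<Sum>j\<in>UNIV. grad j y * Hess j k y)))
      = 2 * (\<Sum>j\<in>UNIV. \<Sum>k\<in>UNIV. grad j y * (\<Gamma> k n m y * Hess j k y))"
      using sum.swap[of "\<lambda>j k. grad j y * (\<Gamma> k n m y * Hess j k y)" UNIV UNIV]
      by (simp add: sum_distrib_left mult_ac)
    have 3: "(\<Sum>j\<in>UNIV. \<Sum>k\<in>UNIV. \<Gamma> j n k y * grad k y * Hess j m y)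
      = (\<Sum>j\<in>UNIV. \<Sum>k\<in>UNIV. grad j y * (\<Gamma> k n j y * Hess k m y))"
      by (subst sum.swap) (simp add: mult_ac)
    have "(\<Sum>j\<in>UNIV. grad j y * partial_deriv n (Hess j m) y + partial_deriv n (grad j) y * Hess j m y)
      = (\<Sum>j\<in>UNIV. grad j y * partial_deriv n (Hess j m) y) + (\<Sum>j\<in>UNIV. \<Sum>a\<in>UNIV. ginv j a y * (Hess a n y * Hess j m y))
       - (\<Sum>j\<in>UNIV. \<Sum>k\<in>UNIV. \<Gamma> j n k y * grad k y * Hess j m y)"
      unfolding partial_deriv_grad[OF y]
      by (simp add: sum_distrib_left sum_distrib_right sum.distrib sum_subtractf algebra_simps)
    moreover have "(\<Sum>j\<in>UNIV. grad j y * DHess n j m y) = (\<Sum>j\<in>UNIV. grad j y * partial_deriv n (Hess j m) y)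
       - (\<Sum>j\<in>UNIV. \<Sum>k\<in>UNIV. grad j y * (\<Gamma> k n j y * Hess k m y))
       - (\<Sum>j\<in>UNIV. \<Sum>k\<in>UNIV. grad j y * (\<Gamma> k n m y * Hess j k y))"
      unfolding DHess_def by (simp add: sum_distrib_left sum_subtractf right_diff_distrib)
    ultimately show ?thesis unfolding 1 2 3 by (simp only: right_diff_distrib distrib_left)
  qed
  have third: "(\<Sum>m\<in>UNIV. \<Sum>n\<in>UNIV. \<Sum>j\<in>UNIV. ginv n m y * (grad j y * DHess n j m y))
    = (\<Sum>j\<in>UNIV. grad j y * (partial_deriv j (laplacian_coords G f) y + (\<Sum>m\<in>UNIV. ricci_coords G y $ j $ m * grad m y)))"
  proof -
    have "(\<Sum>m\<in>UNIV. \<Sum>n\<in>UNIV. ginv n m y * DHess n j m y)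
       = partial_deriv j (laplacian_coords G f) y + (\<Sum>m\<in>UNIV. ricci_coords G y $ j $ m * grad m y)" for j
    proof -
      have "(\<Sum>m\<in>UNIV. \<Sum>n\<in>UNIV. ginv n m y * DHess n j m y)
        = (\<Sum>m\<in>UNIV. \<Sum>n\<in>UNIV. ginv n m y * DHess j n m y)
          - (\<Sum>m\<in>UNIV. \<Sum>n\<in>UNIV. \<Sum>l\<in>UNIV. ginv m n y * riemann G l n j m y * df l y)"
        unfolding ricci_identity[OF y, of _ j]
        by (simp add: sum_distrib_left sum_subtractf ginv_sym[OF y] algebra_simps)
      also have "(\<Sum>m\<in>UNIV. \<Sum>n\<in>UNIV. ginv n m y * DHess j n m y) = partial_deriv j (laplacian_coords G f) y"
        unfolding partial_deriv_laplacian[OF y] by (rule sum.swap)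
      also have "(\<Sum>m\<in>UNIV. \<Sum>n\<in>UNIV. \<Sum>l\<in>UNIV. ginv m n y * riemann G l n j m y * df l y)
        = (\<Sum>l\<in>UNIV. (\<Sum>m\<in>UNIV. \<Sum>n\<in>UNIV. ginv m n y * riemann G l n j m y) * df l y)"
      proof -
        have "(\<Sum>m\<in>UNIV. \<Sum>n\<in>UNIV. \<Sum>l\<in>UNIV. ginv m n y * riemann G l n j m y * df l y)
          = (\<Sum>m\<in>UNIV. \<Sum>l\<in>UNIV. \<Sum>n\<in>UNIV. ginv m n y * riemann G l n j m y * df l y)"
          by (rule sum.cong[OF refl], rule sum.swap)
        also have "\<dots> = (\<Sum>l\<in>UNIV. \<Sum>m\<in>UNIV. \<Sum>n\<in>UNIV. ginv m n y * riemann G l n j m y * df l y)"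
          by (rule sum.swap)
        finally show ?thesis by (simp add: sum_distrib_right)
      qed
      also have "\<dots> = - (\<Sum>l\<in>UNIV. \<Sum>m\<in>UNIV. ricci_coords G y $ j $ m * ginv m l y * df l y)"
        unfolding ricci_contraction[OF y] by (simp add: sum_distrib_right sum_negf)
      also have "(\<Sum>l\<in>UNIV. \<Sum>m\<in>UNIV. ricci_coords G y $ j $ m * ginv m l y * df l y)
        = (\<Sum>m\<in>UNIV. ricci_coords G y $ j $ m * grad m y)"
        by (subst sum.swap) (simp add: grad_def sum_distrib_left mult.assoc)
      finally show ?thesis by simp
    qed
    moreover have "(\<Sum>m\<in>UNIV. \<Sum>n\<in>UNIV. \<Sum>j\<in>UNIV. ginv n m y * (grad j y * DHess n j m y))
      = (\<Sum>j\<in>UNIV. grad j y * (\<Sum>m\<in>UNIV. \<Sum>n\<in>UNIV. ginv n m y * DHess n j m y))"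
    proof -
      have "(\<Sum>m\<in>UNIV. \<Sum>n\<in>UNIV. \<Sum>j\<in>UNIV. ginv n m y * (grad j y * DHess n j m y))
        = (\<Sum>m\<in>UNIV. \<Sum>j\<in>UNIV. \<Sum>n\<in>UNIV. ginv n m y * (grad j y * DHess n j m y))"
        by (rule sum.cong[OF refl], rule sum.swap)
      also have "\<dots> = (\<Sum>j\<in>UNIV. \<Sum>m\<in>UNIV. \<Sum>n\<in>UNIV. ginv n m y * (grad j y * DHess n j m y))"
        by (rule sum.swap)
      finally show ?thesis by (simp add: sum_distrib_left mult_ac)
    qed
    ultimately show ?thesis by simp
  qed
  have "laplacian_coords G grad_sq y = (\<Sum>m\<in>UNIV. \<Sum>n\<in>UNIV. ginv n m y * hessian_coords G grad_sq y $ n $ m)"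
    unfolding laplacian_coords_def ginv_def by (rule sum.swap)
  also have "\<dots> = 2 * (\<Sum>m\<in>UNIV. \<Sum>n\<in>UNIV. \<Sum>j\<in>UNIV. \<Sum>a\<in>UNIV. ginv n m y * (ginv j a y * (Hess a n y * Hess j m y)))
      + 2 * (\<Sum>m\<in>UNIV. \<Sum>n\<in>UNIV. \<Sum>j\<in>UNIV. ginv n m y * (grad j y * DHess n j m y))"
    unfolding hess by (simp add: sum_distrib_left sum.distrib algebra_simps)
  finally show ?thesis
    unfolding third by (simp add: ginv_sym[OF y] sum_distrib_left sum.distrib algebra_simps)
qed

text \<open>
  The shape of the energy at a fixed time \<open>c\<close>.  The summand \<open>|\<nabla>f|\<^sup>2\<close>, from the Laplacian of \<open>f\<^sup>2/2\<close>, is the one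
  that will cancel the time derivative of the weight.
\<close>

lemma laplacian_combination:
  assumes y: "y \<in> V"
  shows "laplacian_coords G (\<lambda>z. c * grad_sq z + (f z)\<^sup>2 / 2) y
    = c * laplacian_coords G grad_sq y + f y * laplacian_coords G f y + grad_sq y"
proof -
  let ?F = "\<lambda>z. c * grad_sq z + (f z)\<^sup>2 / 2"
  have dQ: "z \<in> V \<Longrightarrow> grad_sq differentiable at z" "z \<in> V \<Longrightarrow> partial_deriv m grad_sq differentiable at z"
    and dfd: "z \<in> V \<Longrightarrow> f differentiable at z" for z m
    using ck_grad_sq smooth_f by (auto simp: numeral_2_eq_2 numeral_3_eq_3)
  have F: "?F = (\<lambda>z. c * grad_sq z + (1/2) * (f z * f z))" by (simp add: power2_eq_square)
  have first: "partial_deriv m ?F z = c * partial_deriv m grad_sq z + f z * df m z" if "z \<in> V" for z m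
    unfolding F using that dQ dfd
    by (simp only: partial_deriv_add partial_deriv_cmult partial_deriv_mult differentiable_mult differentiable_const)
      (simp add: algebra_simps)
  have "partial_deriv n (partial_deriv m ?F) y = partial_deriv n (\<lambda>z. c * partial_deriv m grad_sq z + f z * df m z) y" for n m
    by (rule partial_deriv_cong[OF open_V y]) (rule first)
  then have second: "partial_deriv n (partial_deriv m ?F) y
      = c * partial_deriv n (partial_deriv m grad_sq) y + f y * partial_deriv n (df m) y + df n y * df m y" for n m
    using dQ dfd y
    by (simp only: partial_deriv_add partial_deriv_cmult partial_deriv_mult differentiable_mult differentiable_const
        differentiable_f)
  have "hessian_coords G ?F y $ n $ m
      = c * hessian_coords G grad_sq y $ n $ m + f y * hessian_coords G f y $ n $ m + df n y * df m y" for n m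
    unfolding hessian_coords_def vec_lambda_beta second first[OF y]
    by (simp add: sum_distrib_left sum.distrib algebra_simps)
  moreover have "grad_sq y = (\<Sum>n\<in>UNIV. \<Sum>m\<in>UNIV. ginv n m y * (df n y * df m y))"
    by (simp add: grad_sq_def grad_def sum_distrib_left mult_ac)
  ultimately show ?thesis
    by (simp add: laplacian_coords_def ginv_def sum_distrib_left sum.distrib algebra_simps)
qed

lemma grad_sq_nonneg: "y \<in> V \<Longrightarrow> 0 \<le> grad_sq y"
  using ginv_psd[of y "\<lambda>i. df i y"] by (simp add: grad_sq_def grad_def sum_distrib_left mult_ac)

lemma grad_sq_eq: "y \<in> V \<Longrightarrow> gradient_coords G f y \<bullet> (G y *v gradient_coords G f y) = grad_sq y"
  using grad_norm_formula[where G = G and y = y and f = f, OF invertible_G]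
  by (simp add: grad_sq_def grad_def ginv_def sum_distrib_left mult_ac)

end

section \<open>Evolution of the energy along the Ricci flow\<close>

text \<open>
  From \<open>B\<^sup>-\<^sup>1 - A\<^sup>-\<^sup>1 = - B\<^sup>-\<^sup>1 (B - A) A\<^sup>-\<^sup>1\<close> the difference quotient of the inverse converges once the inverse is
  continuous, and continuity follows from Cramer's rule.
\<close>

lemma matrix_inv_has_real_derivative:
  fixes A :: "real \<Rightarrow> real^'n^'n::finite"
  assumes D: "\<And>a b. ((\<lambda>s. A s $ a $ b) has_real_derivative D a b) (at t within S)"
    and inv: "\<And>s. s \<in> S \<Longrightarrow> invertible (A s)" and t: "t \<in> S"
  shows "((\<lambda>s. matrix_inv (A s) $ i $ j) has_real_derivative
      - (\<Sum>a\<in>UNIV. \<Sum>b\<in>UNIV. matrix_inv (A t) $ i $ a * D a b * matrix_inv (A t) $ b $ j)) (at t within S)"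
proof -
  let ?P = "\<lambda>s. matrix_inv (A s)"
  have lim_A: "((\<lambda>s. A s $ a $ b) \<longlongrightarrow> A t $ a $ b) (at t within S)" for a b
    using DERIV_continuous[OF D[of a b]] by (simp add: continuous_within)
  have lim_P: "((\<lambda>s. ?P s $ i $ a) \<longlongrightarrow> ?P t $ i $ a) (at t within S)" for a
  proof -
    have "((\<lambda>s. det (\<chi> c b. if b = i then of_bool (c = a) else A s $ c $ b) / det (A s)) \<longlongrightarrow>
        det (\<chi> c b. if b = i then of_bool (c = a) else A t $ c $ b) / det (A t)) (at t within S)"
    proof (rule tendsto_divide)
      show "((\<lambda>s. det (A s)) \<longlongrightarrow> det (A t)) (at t within S)"
        unfolding det_def by (intro tendsto_intros lim_A)
      have "((\<lambda>s. (\<chi> c b. if b = i then of_bool (c = a) else A s $ c $ b) $ c $ d) \<longlongrightarrow>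
          (\<chi> c b. if b = i then of_bool (c = a) else A t $ c $ b) $ c $ d) (at t within S)" for c d
        using lim_A by (cases "d = i") auto
      then show "((\<lambda>s. det (\<chi> c b. if b = i then of_bool (c = a) else A s $ c $ b)) \<longlongrightarrow>
          det (\<chi> c b. if b = i then of_bool (c = a) else A t $ c $ b)) (at t within S)"
        unfolding det_def by (intro tendsto_sum tendsto_mult tendsto_prod tendsto_const)
      show "det (A t) \<noteq> 0" using inv[OF t] invertible_det_nz by blast
    qed
    moreover have "\<forall>\<^sub>F s in at t within S.
        det (\<chi> c b. if b = i then of_bool (c = a) else A s $ c $ b) / det (A s) = ?P s $ i $ a"
      unfolding eventually_at_filter by (rule always_eventually) (simp add: matrix_inv_entry_det inv)
    ultimately show ?thesis
      unfolding matrix_inv_entry_det[OF inv[OF t]] by (rule Lim_transform_eventually)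
  qed
  have "((\<lambda>s. - (\<Sum>a\<in>UNIV. \<Sum>b\<in>UNIV. ?P s $ i $ a * ((A s $ a $ b - A t $ a $ b) / (s - t)) * ?P t $ b $ j)) \<longlongrightarrow>
      - (\<Sum>a\<in>UNIV. \<Sum>b\<in>UNIV. ?P t $ i $ a * D a b * ?P t $ b $ j)) (at t within S)"
    using D unfolding has_field_derivative_iff by (intro tendsto_intros lim_P)
  moreover have "- (\<Sum>a\<in>UNIV. \<Sum>b\<in>UNIV. ?P s $ i $ a * ((A s $ a $ b - A t $ a $ b) / (s - t)) * ?P t $ b $ j)
      = (?P s $ i $ j - ?P t $ i $ j) / (s - t)" if "s \<in> S" for s
  proof -
    have "?P s ** ((A s - A t) ** ?P t) = ?P s ** A s ** ?P t - ?P s ** (A t ** ?P t)"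
      unfolding matrix_mul_assoc[symmetric]
      by (simp add: vec_eq_iff matrix_matrix_mult_def left_diff_distrib right_diff_distrib sum_subtractf)
    then have "?P t $ i $ j - ?P s $ i $ j = (?P s ** ((A s - A t) ** ?P t)) $ i $ j"
      using matrix_inv_inverse[OF inv[OF that]] matrix_inv_inverse[OF inv[OF t]] by simp
    also have "\<dots> = (\<Sum>a\<in>UNIV. \<Sum>b\<in>UNIV. ?P s $ i $ a * (A s $ a $ b - A t $ a $ b) * ?P t $ b $ j)"
      by (simp add: matrix_matrix_mult_def sum_distrib_left mult.assoc)
    finally have "?P s $ i $ j - ?P t $ i $ j
      = - (\<Sum>a\<in>UNIV. \<Sum>b\<in>UNIV. ?P s $ i $ a * (A s $ a $ b - A t $ a $ b) * ?P t $ b $ j)" by simp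
    then show ?thesis by (simp add: sum_divide_distrib)
  qed
  then have "\<forall>\<^sub>F s in at t within S.
      - (\<Sum>a\<in>UNIV. \<Sum>b\<in>UNIV. ?P s $ i $ a * ((A s $ a $ b - A t $ a $ b) / (s - t)) * ?P t $ b $ j)
      = (?P s $ i $ j - ?P t $ i $ j) / (s - t)"
    unfolding eventually_at_filter by (intro always_eventually) blast
  ultimately show ?thesis
    unfolding has_field_derivative_iff by (rule Lim_transform_eventually)
qed

text \<open>
  The data of the theorem as seen in one chart.  Three space derivatives of the solution are available at
  positive times only, hence the half-open interval in \<open>smooth_w\<close>.
\<close>

locale coord_flow =
  fixes V :: "(real^'n::finite) set" and T l :: real and G :: "real \<Rightarrow> real^'n \<Rightarrow> real^'n^'n"
    and h :: "real \<Rightarrow> real" and w :: "real \<Rightarrow> real^'n \<Rightarrow> real"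
  assumes open_V: "open V"
    and smooth_G: "\<And>i j. C_k_in_space 2 (\<lambda>t y. G t y $ i $ j) {0..T} V"
    and sym_G: "\<And>t y. t \<in> {0..T} \<Longrightarrow> y \<in> V \<Longrightarrow> transpose (G t y) = G t y"
    and pos_G: "\<And>t y v. t \<in> {0..T} \<Longrightarrow> y \<in> V \<Longrightarrow> v \<noteq> 0 \<Longrightarrow> 0 < v \<bullet> (G t y *v v)"
    and flow: "\<And>t y. t \<in> {0..T} \<Longrightarrow> y \<in> V \<Longrightarrow>
      ((\<lambda>s. G s y) has_vector_derivative (-2) *\<^sub>R ricci_coords (G t) y) (at t within {0..T})"
    and smooth_w: "C_k_in_space 3 w {0<..T} V"
    and heat: "\<And>t y. t \<in> {0..T} \<Longrightarrow> y \<in> V \<Longrightarrow>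
      ((\<lambda>s. w s y) has_real_derivative laplacian_coords (G t) (w t) y + h t * w t y powr (l - 1)) (at t within {0..T})"
    and pos_w: "\<And>t y. t \<in> {0..T} \<Longrightarrow> y \<in> V \<Longrightarrow> 0 < w t y"
    and cont_h: "continuous_on {0..T} h"
    and h_nonpos: "\<And>t. t \<in> {0..T} \<Longrightarrow> h t \<le> 0"
    and l_ge_1: "1 \<le> l"
begin

abbreviation energy :: "real \<Rightarrow> real^'n \<Rightarrow> real" where
  "energy t y \<equiv> t * coord_function.grad_sq (G t) (w t) y + (w t y)\<^sup>2 / 2"

lemma invertible_flow: "t \<in> {0..T} \<Longrightarrow> y \<in> V \<Longrightarrow> invertible (G t y)"
  using pos_G by (intro posdef_invertible) auto

lemma coord_metric_at: "t \<in> {0..T} \<Longrightarrow> coord_metric V (G t)"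
  by unfold_locales
    (use open_V sym_G pos_G C_k_in_space_at[OF smooth_G] in auto)

lemma coord_function_at: "t \<in> {0<..T} \<Longrightarrow> coord_function V (G t) (w t)"
  using coord_metric_at[of t] C_k_in_space_at[OF smooth_w]
  unfolding coord_function_def coord_function_axioms_def by auto

lemma at_within_positive: "0 < t \<Longrightarrow> at t within {0<..T} = at t within {0..T}"
  by (rule at_within_nhd[of _ "{0<..}"]) auto

text \<open>
  The equation for \<open>w\<close>, differentiated in space.  The right-hand side of the heat equation is of class
  \<open>C\<^sup>1\<close> in space at positive times, which is what \<open>mixed_derivative\<close> asks for.
\<close>

lemma df_evolution:
  assumes t: "t \<in> {0<..T}" and y: "y \<in> V"
  shows "((\<lambda>s. partial_deriv i (w s) y) has_real_derivative
      partial_deriv i (laplacian_coords (G t) (w t)) y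
      + h t * (l - 1) * w t y powr (l - 2) * partial_deriv i (w t) y) (at t within {0..T})"
proof -
  let ?I = "{0<..T}"
  let ?rhs = "\<lambda>t y. laplacian_coords (G t) (w t) y + h t * w t y powr (l - 1)"
  have sub: "?I \<subseteq> {0..T}" by auto
  have ck_lap: "C_k_in_space 1 (\<lambda>t. laplacian_coords (G t) (w t)) ?I V"
    using C_k_in_space_laplacian[OF open_V, of 1 G ?I w] C_k_in_space_subset[OF smooth_G sub] smooth_w invertible_flow
    by (simp add: numeral_2_eq_2 numeral_3_eq_3)
  have ck_w: "C_k_in_space 1 (\<lambda>t y. w t y powr (l - 1)) ?I V"
    by (rule C_k_in_space_powr[OF open_V _ C_k_in_space_le[OF smooth_w]]) (use pos_w in auto)
  have ck_rhs: "C_k_in_space 1 ?rhs ?I V"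
    by (intro C_k_in_space_add C_k_in_space_mult C_k_in_space_time ck_lap ck_w open_V
        continuous_on_subset[OF cont_h sub])
  have "((\<lambda>s. partial_deriv i (w s) y) has_real_derivative partial_deriv i (?rhs t) y) (at t within ?I)"
  proof (rule mixed_derivative[OF open_V y _ t _ _ ck_rhs])
    show "w s differentiable at y" if "s \<in> ?I" for s
      using C_k_in_space_differentiable[OF smooth_w _ that y] by simp
    show "((\<lambda>s. w s z) has_real_derivative ?rhs s z) (at s within ?I)" if "s \<in> ?I" "z \<in> V" for s z
      by (rule DERIV_subset[OF heat sub]) (use that in auto)
  qed auto
  moreover have "partial_deriv i (?rhs t) y = partial_deriv i (laplacian_coords (G t) (w t)) y
      + h t * ((l - 1) * w t y powr (l - 1 - 1) * partial_deriv i (w t) y)"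
  proof -
    have "w t differentiable at y" "laplacian_coords (G t) (w t) differentiable at y"
      "(\<lambda>y. w t y powr (l - 1)) differentiable at y"
      using smooth_w ck_lap ck_w t y by (auto simp: numeral_3_eq_3)
    then show ?thesis
      using partial_deriv_powr[of "w t" y i "l - 1"] pos_w[of t y] t y
      by (simp add: partial_deriv_add partial_deriv_cmult)
  qed
  ultimately show ?thesis
    using t by (simp add: at_within_positive algebra_simps)
qed

text \<open>
  The heart of the argument.  In \<open>\<partial>\<^sub>t |\<nabla>w|\<^sup>2\<close> the evolution of the inverse metric contributes
  \<open>2 Ric(\<nabla>w, \<nabla>w)\<close> and that of \<open>dw\<close> contributes \<open>2\<langle>\<nabla>w, \<nabla>\<Delta>w\<rangle> + 2c|\<nabla>w|\<^sup>2\<close> with \<open>c = h (l-1) w\<^bsup>l-2\<^esup>\<close>.  The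
  Ricci term and the term with \<open>\<nabla>\<Delta>w\<close> appear in Bochner's formula as well, so the difference of the two sides is
  \<open>2t|Hess w|\<^sup>2 - 2tc|\<nabla>w|\<^sup>2 - h w\<^sup>l\<close>, where every summand is nonnegative because \<open>h \<le> 0\<close> and \<open>l \<ge> 1\<close>.
\<close>

lemma energy_subsolution:
  assumes t: "t \<in> {0<..T}" and y: "y \<in> V"
  shows "\<exists>D. ((\<lambda>s. energy s y) has_real_derivative D) (at t within {0..T})
      \<and> D \<le> laplacian_coords (G t) (energy t) y"
proof -
  interpret coord_function V "G t" "w t" by (rule coord_function_at[OF t])
  have t0: "t \<in> {0..T}" using t by auto
  let ?R = "ricci_coords (G t) y"
  let ?c = "h t * (l - 1) * w t y powr (l - 2)"
  let ?L = "laplacian_coords (G t) (w t)"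
  define dP where "dP i j = 2 * (\<Sum>a\<in>UNIV. \<Sum>b\<in>UNIV. ginv i a y * ?R $ a $ b * ginv b j y)" for i j
  define dw where "dw i = partial_deriv i ?L y + ?c * df i y" for i
  have G_t: "((\<lambda>s. G s y $ a $ b) has_real_derivative (-2) * ?R $ a $ b) (at t within {0..T})" for a b
    using bounded_linear.has_vector_derivative[OF bounded_linear_compose[OF bounded_linear_vec_nth bounded_linear_vec_nth], OF flow[OF t0 y], of a b]
    by (simp add: has_real_derivative_iff_has_vector_derivative)
  have P_t: "((\<lambda>s. matrix_inv (G s y) $ i $ j) has_real_derivative dP i j) (at t within {0..T})" for i j
    using matrix_inv_has_real_derivative[OF G_t invertible_flow[OF _ y] t0, of i j]
    by (simp add: dP_def ginv_def sum_negf sum_distrib_left mult_ac)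
  have w_t: "((\<lambda>s. partial_deriv i (w s) y) has_real_derivative dw i) (at t within {0..T})" for i
    unfolding dw_def by (rule df_evolution[OF t y])
  define dQ where "dQ = (\<Sum>j\<in>UNIV. \<Sum>i\<in>UNIV. dP j i * df i y * df j y + ginv j i y * (dw i * df j y + df i y * dw j))"
  have grad_sq_unfold: "coord_function.grad_sq (G s) (w s) y
      = (\<Sum>j\<in>UNIV. \<Sum>i\<in>UNIV. matrix_inv (G s y) $ j $ i * (partial_deriv i (w s) y * partial_deriv j (w s) y))"
    if "s \<in> {0<..T}" for s
  proof -
    interpret s: coord_function V "G s" "w s" by (rule coord_function_at[OF that])
    show ?thesis by (simp add: s.grad_sq_def s.grad_def s.ginv_def sum_distrib_left mult_ac)
  qed
  have "((\<lambda>s. \<Sum>j\<in>UNIV. \<Sum>i\<in>UNIV. matrix_inv (G s y) $ j $ i * (partial_deriv i (w s) y * partial_deriv j (w s) y))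
      has_real_derivative dQ) (at t within {0..T})"
    unfolding dQ_def
    by (auto intro!: derivative_eq_intros P_t w_t sum.cong simp: ginv_def algebra_simps)
  then have "((\<lambda>s. coord_function.grad_sq (G s) (w s) y) has_real_derivative dQ) (at t within {0..T})"
    by (rule has_field_derivative_transform_within[where d = t]) (use t grad_sq_unfold in \<open>auto simp: dist_real_def\<close>)
  then have E_t: "((\<lambda>s. energy s y) has_real_derivative
      grad_sq y + t * dQ + w t y * (?L y + h t * w t y powr (l - 1))) (at t within {0..T})"
    using heat[OF t0 y] by (auto intro!: derivative_eq_intros simp: algebra_simps)
  have "dQ = 2 * (\<Sum>j\<in>UNIV. \<Sum>m\<in>UNIV. grad j y * grad m y * ?R $ j $ m)
      + 2 * (\<Sum>j\<in>UNIV. grad j y * partial_deriv j ?L y) + 2 * ?c * grad_sq y"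
  proof -
    have "(\<Sum>j\<in>UNIV. \<Sum>i\<in>UNIV. dP j i * df i y * df j y)
      = (\<Sum>j\<in>UNIV. \<Sum>i\<in>UNIV. \<Sum>a\<in>UNIV. \<Sum>b\<in>UNIV. 2 * ((ginv a j y * df j y) * (ginv b i y * df i y) * ?R $ a $ b))"
      by (simp add: dP_def sum_distrib_left sum_distrib_right ginv_sym[OF y, of _ a for a] mult_ac)
    also have "\<dots> = (\<Sum>a\<in>UNIV. \<Sum>b\<in>UNIV. \<Sum>j\<in>UNIV. \<Sum>i\<in>UNIV. 2 * ((ginv a j y * df j y) * (ginv b i y * df i y) * ?R $ a $ b))"
      by (rule sum_swap_pairs)
    also have "\<dots> = 2 * (\<Sum>a\<in>UNIV. \<Sum>b\<in>UNIV. grad a y * grad b y * ?R $ a $ b)"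
      unfolding grad_def sum_product by (simp add: sum_distrib_left sum_distrib_right)
    finally have 1: "(\<Sum>j\<in>UNIV. \<Sum>i\<in>UNIV. dP j i * df i y * df j y) = 2 * (\<Sum>a\<in>UNIV. \<Sum>b\<in>UNIV. grad a y * grad b y * ?R $ a $ b)" .
    have 2: "(\<Sum>j\<in>UNIV. \<Sum>i\<in>UNIV. ginv j i y * (df i y * dw j)) = (\<Sum>j\<in>UNIV. grad j y * dw j)"
      by (simp add: grad_def sum_distrib_left sum_distrib_right mult_ac)
    have 3: "(\<Sum>j\<in>UNIV. \<Sum>i\<in>UNIV. ginv j i y * (dw i * df j y)) = (\<Sum>j\<in>UNIV. grad j y * dw j)"
      by (subst sum.swap) (simp add: grad_def ginv_sym[OF y] sum_distrib_left sum_distrib_right mult_ac)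
    have 4: "(\<Sum>j\<in>UNIV. grad j y * dw j) = (\<Sum>j\<in>UNIV. grad j y * partial_deriv j ?L y) + ?c * grad_sq y"
      by (simp add: dw_def grad_sq_def sum_distrib_left sum.distrib distrib_left mult_ac)
    show ?thesis
      unfolding dQ_def by (simp only: distrib_left sum.distrib 1 2 3 4)
  qed
  moreover have "laplacian_coords (G t) (energy t) y = t * laplacian_coords (G t) grad_sq y + w t y * ?L y + grad_sq y"
    by (rule laplacian_combination[OF y])
  moreover have "0 \<le> (\<Sum>m\<in>UNIV. \<Sum>n\<in>UNIV. \<Sum>j\<in>UNIV. \<Sum>a\<in>UNIV. ginv m n y * (ginv j a y * (Hess a n y * Hess j m y)))"
    (is "0 \<le> ?N")
    by (rule psd_square_nonneg) (use ginv_sym[OF y] ginv_psd[OF y] in auto)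
  moreover have "?c \<le> 0" "h t * w t y powr (l - 1) \<le> 0"
    using h_nonpos[OF t0] l_ge_1 by (auto intro!: mult_nonpos_nonneg)
  moreover have "0 < w t y" by (rule pos_w[OF t0 y])
  ultimately have *: "laplacian_coords (G t) (energy t) y - (grad_sq y + t * dQ + w t y * (?L y + h t * w t y powr (l - 1)))
      = 2 * t * ?N + 2 * t * grad_sq y * (- ?c) + w t y * (- (h t * w t y powr (l - 1)))"
    by (simp only: bochner_formula[OF y]) (simp add: algebra_simps)
  have "0 \<le> 2 * t * ?N + 2 * t * grad_sq y * (- ?c) + w t y * (- (h t * w t y powr (l - 1)))"
    using t \<open>0 \<le> ?N\<close> grad_sq_nonneg[OF y] \<open>?c \<le> 0\<close> \<open>h t * w t y powr (l - 1) \<le> 0\<close> \<open>0 < w t y\<close>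
    by (intro add_nonneg_nonneg mult_nonneg_nonneg) auto
  then show ?thesis using E_t * by (intro exI conjI) (assumption, linarith)
qed

end

lemma (in coord_flow) C_k_energy:
  assumes "t \<in> {0<..T}" shows "C_k_in_space 2 (\<lambda>_. energy t) {0} V"
proof -
  interpret coord_function V "G t" "w t" by (rule coord_function_at[OF assms])
  have "ck 2 (\<lambda>y. t * grad_sq y + (1/2) * (w t y * w t y))"
    by (intro C_k_in_space_add C_k_in_space_mult C_k_in_space_time ck_grad_sq C_k_in_space_le[OF smooth_f]
        open_V continuous_on_const) auto
  then show ?thesis by (simp add: power2_eq_square)
qed

section \<open>Derivatives at a maximum\<close>

lemma DERIV2_nonpos_at_local_max:
  fixes \<phi> :: "real \<Rightarrow> real"
  assumes "0 < r" and d1: "\<And>s. \<bar>s\<bar> < r \<Longrightarrow> (\<phi> has_real_derivative \<phi>' s) (at s)"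
    and d2: "(\<phi>' has_real_derivative D) (at 0)" and max: "\<And>s. \<bar>s\<bar> < r \<Longrightarrow> \<phi> s \<le> \<phi> 0"
  shows "\<phi>' 0 = 0" "D \<le> 0"
proof -
  show zero: "\<phi>' 0 = 0"
    by (rule DERIV_local_max[OF d1, of 0 r]) (use assms(1) max in auto)
  show "D \<le> 0"
  proof (rule ccontr)
    assume "\<not> D \<le> 0"
    then obtain d where d: "d > 0" "\<And>h. 0 < h \<Longrightarrow> h < d \<Longrightarrow> \<phi>' 0 < \<phi>' (0 + h)"
      using DERIV_pos_inc_right[OF d2] by force
    define s where "s = min d r / 2"
    have s: "0 < s" "s < d" "s < r" using d assms(1) by (auto simp: s_def min_def)
    have "\<exists>z. 0 < z \<and> z < s \<and> \<phi> s - \<phi> 0 = (s - 0) * \<phi>' z"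
      by (rule MVT2[OF s(1)]) (use s d1 in auto)
    then obtain z where z: "0 < z" "z < s" "\<phi> s - \<phi> 0 = s * \<phi>' z" by auto
    then have "0 < s * \<phi>' z" using d(2)[of z] s zero by simp
    moreover have "\<phi> s \<le> \<phi> 0" using max[of s] s by simp
    ultimately show False using z(3) by simp
  qed
qed

text \<open>
  One-sided, so that it applies at the right end point \<open>t = b\<close> as well.
\<close>

lemma DERIV_nonneg_at_max_over_past:
  fixes f :: "real \<Rightarrow> real"
  assumes f: "(f has_real_derivative D) (at t within {a..b})" and t: "a < t" "t \<le> b"
    and max: "\<And>s. s \<in> {a..t} \<Longrightarrow> f s \<le> f t"
  shows "0 \<le> D"
proof (rule ccontr)
  assume "\<not> 0 \<le> D"
  then obtain d where d: "d > 0" "\<And>h. 0 < h \<Longrightarrow> t - h \<in> {a..b} \<Longrightarrow> h < d \<Longrightarrow> f t < f (t - h)"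
    using has_real_derivative_neg_dec_left[OF f] by force
  define h where "h = min d (t - a) / 2"
  have "0 < h" "h < d" "t - h \<in> {a..b}" "t - h \<in> {a..t}" using d t by (auto simp: h_def min_def field_simps)
  then show False using d(2)[of h] max[of "t - h"] by fastforce
qed

lemma frechet_derivative_partial:
  fixes f :: "real^'n::finite \<Rightarrow> real"
  assumes "f differentiable at y"
  shows "frechet_derivative f (at y) v = (\<Sum>k\<in>UNIV. v $ k * partial_deriv k f y)"
proof -
  let ?L = "frechet_derivative f (at y)"
  have lin: "linear ?L" by (rule linear_frechet_derivative[OF assms])
  have "?L v = ?L (\<Sum>k\<in>UNIV. v $ k *\<^sub>R axis k 1)"
    using basis_expansion[of v] by (simp add: scalar_mult_eq_scaleR)
  also have "\<dots> = (\<Sum>k\<in>UNIV. v $ k * ?L (axis k 1))"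
    by (simp add: linear_sum[OF lin] linear_cmul[OF lin])
  finally show ?thesis by (simp add: partial_deriv_def)
qed

lemma has_real_derivative_along_line:
  fixes f :: "real^'n::finite \<Rightarrow> real"
  assumes "f differentiable at (y + s *\<^sub>R v)"
  shows "((\<lambda>s. f (y + s *\<^sub>R v)) has_real_derivative
    (\<Sum>k\<in>UNIV. v $ k * partial_deriv k f (y + s *\<^sub>R v))) (at s)"
proof -
  let ?L = "frechet_derivative f (at (y + s *\<^sub>R v))"
  have "((\<lambda>s. f (y + s *\<^sub>R v)) has_derivative (\<lambda>h. ?L (h *\<^sub>R v))) (at s)"
    by (rule has_derivative_compose[where g = f], (auto intro!: derivative_eq_intros)[1])
      (rule has_derivative_frechet[OF assms])
  moreover have "(\<lambda>h. ?L (h *\<^sub>R v)) = (*) (\<Sum>k\<in>UNIV. v $ k * partial_deriv k f (y + s *\<^sub>R v))"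
    by (simp add: frechet_derivative_partial[OF assms] fun_eq_iff sum_distrib_left sum_distrib_right mult_ac)
  ultimately show ?thesis by (simp add: has_field_derivative_def)
qed

text \<open>
  At a maximum the first derivatives vanish, so the Christoffel terms drop out and the Laplacian is
  the contraction of the inverse metric with the negative semidefinite matrix of second partials.
\<close>

lemma (in coord_metric) laplacian_nonpos_at_max:
  assumes y: "y \<in> V" and F: "ck 2 F" and max: "\<And>z. z \<in> V \<Longrightarrow> F z \<le> F y"
  shows "laplacian_coords G F y \<le> 0"
proof -
  have dF: "z \<in> V \<Longrightarrow> F differentiable at z" "z \<in> V \<Longrightarrow> partial_deriv k F differentiable at z" for z k
    using F by (auto simp: numeral_2_eq_2)
  obtain r where r: "r > 0" "ball y r \<subseteq> V" using open_V y by (meson open_contains_ball)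
  have test: "(\<Sum>k\<in>UNIV. v $ k * partial_deriv k F y) = 0"
    "(\<Sum>i\<in>UNIV. \<Sum>j\<in>UNIV. v $ i * v $ j * partial_deriv i (partial_deriv j F) y) \<le> 0" for v
  proof -
    \<comment> \<open>The summand \<open>1\<close> covers \<open>v = 0\<close>.\<close>
    define \<rho> where "\<rho> = r / (norm v + 1)"
    have \<rho>: "0 < \<rho>" using r by (simp add: \<rho>_def add_nonneg_pos)
    have line: "y + s *\<^sub>R v \<in> V" if "\<bar>s\<bar> < \<rho>" for s
    proof -
      have "\<bar>s\<bar> * norm v \<le> \<bar>s\<bar> * (norm v + 1)" by (intro mult_left_mono) auto
      also have "\<dots> < r" using that by (simp add: \<rho>_def pos_less_divide_eq add_nonneg_pos)
      finally show ?thesis using r(2) by (auto simp: dist_norm)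
    qed
    let ?\<phi>' = "\<lambda>s. \<Sum>j\<in>UNIV. v $ j * partial_deriv j F (y + s *\<^sub>R v)"
    have d1: "((\<lambda>s. F (y + s *\<^sub>R v)) has_real_derivative ?\<phi>' s) (at s)" if "\<bar>s\<bar> < \<rho>" for s
      by (rule has_real_derivative_along_line) (use dF line that in auto)
    have "(?\<phi>' has_real_derivative
        (\<Sum>j\<in>UNIV. v $ j * (\<Sum>i\<in>UNIV. v $ i * partial_deriv i (partial_deriv j F) (y + 0 *\<^sub>R v)))) (at 0)"
      by (intro DERIV_sum DERIV_cmult has_real_derivative_along_line) (use dF y in auto)
    from DERIV2_nonpos_at_local_max[OF \<rho> d1 this] max line
    have "?\<phi>' 0 = 0" "(\<Sum>j\<in>UNIV. v $ j * (\<Sum>i\<in>UNIV. v $ i * partial_deriv i (partial_deriv j F) y)) \<le> 0"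
      by simp_all
    moreover have "(\<Sum>j\<in>UNIV. v $ j * (\<Sum>i\<in>UNIV. v $ i * partial_deriv i (partial_deriv j F) y))
      = (\<Sum>i\<in>UNIV. \<Sum>j\<in>UNIV. v $ i * v $ j * partial_deriv i (partial_deriv j F) y)"
      by (subst sum.swap) (simp add: sum_distrib_left mult_ac)
    ultimately show "(\<Sum>k\<in>UNIV. v $ k * partial_deriv k F y) = 0"
      "(\<Sum>i\<in>UNIV. \<Sum>j\<in>UNIV. v $ i * v $ j * partial_deriv i (partial_deriv j F) y) \<le> 0" by simp_all
  qed
  have grad: "partial_deriv k F y = 0" for k
    using test(1)[of "axis k 1"] by (simp add: axis_def of_bool_def if_distrib[of "\<lambda>x. x * _"] cong: if_cong)
  have "laplacian_coords G F y = (\<Sum>i\<in>UNIV. \<Sum>j\<in>UNIV. ginv i j y * partial_deriv i (partial_deriv j F) y)"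
    by (simp add: laplacian_coords_def hessian_coords_def grad ginv_def)
  also have "\<dots> \<le> 0"
  proof (rule psd_trace_nonpos[OF ginv_sym[OF y] ginv_psd[OF y]])
    fix v :: "'n \<Rightarrow> real"
    show "(\<Sum>i\<in>UNIV. \<Sum>j\<in>UNIV. v i * v j * partial_deriv i (partial_deriv j F) y) \<le> 0"
      using test(2)[of "\<chi> i. v i"] by simp
  qed
  finally show ?thesis .
qed

section \<open>From charts to the manifold\<close>

text \<open>
  The space derivative of a slice is the joint derivative in the direction \<open>(0, e\<^sub>i)\<close>.  The map \<open>L\<close>, later the
  extraction of one entry of a matrix, is part of the induction so that vector-valued \<open>F\<close> are allowed.
\<close>

lemma C_k_on_imp_C_k_in_space:
  fixes F :: "real \<times> (real^'n::finite) \<Rightarrow> 'w::real_normed_vector" and L :: "'w \<Rightarrow> real"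
  assumes V: "open V" and L: "bounded_linear L"
  shows "C_k_on k F (I \<times> V) \<Longrightarrow> C_k_in_space k (\<lambda>t y. L (F (t, y))) I V"
proof (induction k arbitrary: F)
  case 0
  then show ?case
    using bounded_linear.continuous_on[OF L, of "I \<times> V" F] by (simp add: case_prod_unfold)
next
  case (Suc k)
  let ?F' = "\<lambda>p. frechet_derivative F (at p within I \<times> V)"
  have diff: "F differentiable (at p within I \<times> V)" if "p \<in> I \<times> V" for p
    using Suc.prems that unfolding C_k_on.simps by blast
  have "continuous_on (I \<times> V) F"
    by (rule differentiable_imp_continuous_on) (use diff in \<open>simp add: differentiable_on_def\<close>)
  then have cont: "continuous_on (I \<times> V) (\<lambda>(t, y). L (F (t, y)))"
    using bounded_linear.continuous_on[OF L, of "I \<times> V" F] by (simp add: case_prod_unfold)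
  have der: "((\<lambda>y. L (F (t, y))) has_derivative (\<lambda>v. L (?F' (t, y) (0, v)))) (at y)"
    if "t \<in> I" "y \<in> V" for t y
  proof -
    have "(F has_derivative ?F' (t, y)) (at (t, y) within I \<times> V)"
      using diff that by (simp add: frechet_derivative_works)
    then have "(F has_derivative ?F' (t, y)) (at (t, y) within Pair t ` V)"
      by (rule has_derivative_subset) (use that in auto)
    moreover have "(Pair t has_derivative (\<lambda>v. (0, v))) (at y within V)"
      by (auto intro!: derivative_eq_intros)
    ultimately have "((\<lambda>y. F (t, y)) has_derivative (\<lambda>v. ?F' (t, y) (0, v))) (at y within V)"
      using has_derivative_in_compose[of "Pair t" _ y V F] by blast
    then have "((\<lambda>y. F (t, y)) has_derivative (\<lambda>v. ?F' (t, y) (0, v))) (at y)"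
      using at_within_open[OF that(2) V] by simp
    then show ?thesis by (rule bounded_linear.has_derivative[OF L])
  qed
  have "C_k_in_space k (\<lambda>t y. partial_deriv i (\<lambda>y. L (F (t, y))) y) I V" for i
  proof (subst C_k_in_space_cong[OF V])
    show "partial_deriv i (\<lambda>y. L (F (t, y))) y = L (?F' (t, y) (0, axis i 1))" if "t \<in> I" "y \<in> V" for t y
      by (rule partial_deriv_eq[OF der[OF that]])
    show "C_k_in_space k (\<lambda>t y. L (?F' (t, y) (0, axis i 1))) I V"
      by (rule Suc.IH) (use Suc.prems in auto)
  qed
  then show ?case using cont der by (auto simp: differentiable_def)
qed

lemma in_coords_cmap:
  assumes "is_chart M c" "p \<in> cdom c"
  shows "in_coords c f (cmap c p) = f p"
proof -
  have "topspace M \<inter> cdom c = cdom c"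
    using assms(1) openin_subset unfolding is_chart_def by blast
  then have "inj_on (cmap c) (cdom c)"
    using assms(1) unfolding is_chart_def homeomorphic_eq_everything_map by simp
  then show ?thesis using assms(2) by (simp add: in_coords_def)
qed

lemma open_chart_image:
  assumes "is_chart M c" "openin M U" "U \<subseteq> cdom c"
  shows "open (cmap c ` U)"
proof -
  have "openin (subtopology M (cdom c)) U"
    using assms by (simp add: is_chart_def openin_open_subtopology)
  then have "openin (top_of_set (cimage c)) (cmap c ` U)"
    using assms(1) homeomorphic_imp_open_map unfolding is_chart_def open_map_def by blast
  then show ?thesis using assms(1) by (simp add: is_chart_def openin_open_eq)
qed

text \<open>
  With \<open>J\<close> the Jacobian of the change of coordinates the metrics satisfy \<open>A = J\<^sup>T B J\<close> and the differentials
  \<open>a = J\<^sup>T b\<close>.  Hence \<open>J\<close> is invertible, \<open>J\<close> maps the gradient \<open>A\<^sup>-\<^sup>1 a\<close> to the gradient \<open>B\<^sup>-\<^sup>1 b\<close>, and preserves its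
  length.
\<close>

lemma grad_norm_sq_chart_independent:
  fixes c d :: "('a, 'n::finite) chart"
  assumes at: "smooth_atlas M \<A>" and met: "riemannian_metric \<A> g"
    and c: "c \<in> \<A>" "p \<in> cdom c" and d: "d \<in> \<A>" "p \<in> cdom d"
    and f: "in_coords d f differentiable at (cmap d p)"
  shows "grad_norm_sq g c f p = grad_norm_sq g d f p"
proof -
  have ch: "is_chart M c" "is_chart M d" using at c d by (auto simp: smooth_atlas_def)
  let ?U = "cmap c ` (cdom c \<inter> cdom d)" and ?y = "cmap c p" and ?\<psi> = "transition c d"
  define J where "J = jacobian ?\<psi> (at ?y)"
  let ?A = "g c p" and ?B = "g d p"
  have U: "open ?U" "?y \<in> ?U"
    using ch c d by (auto intro!: open_chart_image[of M] openin_Int simp: is_chart_def)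
  have "C_k_on (Suc 0) ?\<psi> ?U"
    using at c d unfolding smooth_atlas_def smooth_on_def by blast
  then have "?\<psi> differentiable (at ?y within ?U)"
    using U(2) unfolding C_k_on.simps by blast
  then have "?\<psi> differentiable at ?y" using at_within_open[OF U(2,1)] by simp
  then have d\<psi>: "(?\<psi> has_derivative (*v) J) (at ?y)"
    by (simp add: J_def jacobian_works[symmetric])
  have \<psi>y: "?\<psi> ?y = cmap d p" by (simp add: transition_def in_coords_cmap[OF ch(1) c(2)])
  define b where "b = (\<chi> k. partial_deriv k (in_coords d f) (cmap d p))"
  define a where "a = (\<chi> i. partial_deriv i (in_coords c f) ?y)"
  have ab: "a = transpose J *v b"
  proof -
    have "((\<lambda>y. in_coords d f (?\<psi> y)) has_derivative
        (\<lambda>v. frechet_derivative (in_coords d f) (at (cmap d p)) (J *v v))) (at ?y)"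
      by (rule has_derivative_compose[OF d\<psi>]) (use f \<psi>y has_derivative_frechet in auto)
    moreover have "in_coords d f (?\<psi> y) = in_coords c f y" if "y \<in> ?U" for y
      using that by (auto simp: transition_def in_coords_cmap[OF ch(1)] in_coords_cmap[OF ch(2)])
    ultimately have "(in_coords c f has_derivative
        (\<lambda>v. frechet_derivative (in_coords d f) (at (cmap d p)) (J *v v))) (at ?y)"
      using has_derivative_transform_within_open[OF _ U] by blast
    from partial_deriv_eq[OF this]
    have "partial_deriv i (in_coords c f) ?y = (\<Sum>k\<in>UNIV. J $ k $ i * b $ k)" for i
      unfolding frechet_derivative_partial[OF f]
      by (simp add: b_def matrix_vector_mul_component inner_axis)
    then show ?thesis
      by (simp add: a_def vec_eq_iff matrix_vector_mult_def transpose_def)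
  qed
  have pos: "v \<bullet> (?A *v v) > 0" "v \<bullet> (?B *v v) > 0" if "v \<noteq> 0" for v
    using met c d that unfolding riemannian_metric_def by auto
  have invA: "invertible ?A" and invB: "invertible ?B"
    using pos by (auto intro: posdef_invertible)
  have AB: "?A = transpose J ** ?B ** J"
    using met c d unfolding riemannian_metric_def Let_def J_def by blast
  have "det ?A \<noteq> 0" using invA invertible_det_nz by blast
  then have "det (transpose J) \<noteq> 0" by (auto simp: AB det_mul)
  then have invJ: "invertible (transpose J)" using invertible_det_nz by blast
  define v where "v = matrix_inv ?A *v a"
  have "?A *v v = a" by (simp add: v_def matrix_vector_mul_assoc matrix_inv_inverse[OF invA])
  then have eq: "transpose J *v (?B *v (J *v v)) = transpose J *v b"
    by (simp add: AB ab matrix_vector_mul_assoc matrix_mul_assoc)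
  have cancel: "matrix_inv K *v (K *v z) = z" if "invertible K" for K :: "real^'n^'n" and z
    by (simp add: matrix_vector_mul_assoc matrix_inv_inverse[OF that])
  have Bw: "?B *v (J *v v) = b"
    using arg_cong[OF eq, of "(*v) (matrix_inv (transpose J))"] by (simp only: cancel[OF invJ])
  have w: "J *v v = matrix_inv ?B *v b"
    using arg_cong[OF Bw, of "(*v) (matrix_inv ?B)"] by (simp only: cancel[OF invB])
  have adj: "v \<bullet> (transpose J *v z) = (J *v v) \<bullet> z" for z
    by (simp add: inner_commute[of v] dot_lmul_matrix inner_commute[of "J *v v"])
  have "v \<bullet> (?A *v v) = v \<bullet> (transpose J *v (?B *v (J *v v)))"
    by (simp only: AB matrix_vector_mul_assoc matrix_mul_assoc)
  then have "v \<bullet> (?A *v v) = (J *v v) \<bullet> (?B *v (J *v v))"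
    by (simp only: adj)
  moreover have "grad_norm_sq g c f p = v \<bullet> (?A *v v)"
    by (simp add: grad_norm_sq_def Let_def gradient_coords_def v_def a_def in_coords_cmap[OF ch(1) c(2)])
  moreover have "grad_norm_sq g d f p = (J *v v) \<bullet> (?B *v (J *v v))"
    by (simp add: grad_norm_sq_def Let_def gradient_coords_def w b_def in_coords_cmap[OF ch(2) d(2)])
  ultimately show ?thesis by simp
qed

text \<open>
  The products of chart domains with \<open>I\<close> form an open cover of \<open>M \<times> I\<close>, and continuity is a local property.
\<close>

lemma continuous_map_chartwise:
  fixes F :: "'a \<Rightarrow> 's::topological_space \<Rightarrow> real"
  assumes at: "smooth_atlas M \<A>"
    and loc: "\<And>c. c \<in> \<A> \<Longrightarrow> continuous_on (I \<times> cimage c) (\<lambda>(t, y). E c t y)"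
    and F: "\<And>c x t. c \<in> \<A> \<Longrightarrow> x \<in> cdom c \<Longrightarrow> t \<in> I \<Longrightarrow> F x t = E c t (cmap c x)"
  shows "continuous_map (prod_topology M (top_of_set I)) euclideanreal (\<lambda>(x, t). F x t)"
proof (rule pasting_lemma[where I = \<A> and T = "\<lambda>c. cdom c \<times> I" and f = "\<lambda>c (x, t). F x t"])
  fix c assume c: "c \<in> \<A>"
  have ch: "is_chart M c" using at c by (auto simp: smooth_atlas_def)
  show "openin (prod_topology M (top_of_set I)) (cdom c \<times> I)"
    using ch openin_subtopology_self unfolding openin_prod_Times_iff is_chart_def by blast
  have top: "subtopology (prod_topology M (top_of_set I)) (cdom c \<times> I)
      = prod_topology (subtopology M (cdom c)) (top_of_set I)"
    by (simp only: subtopology_Times subtopology_subtopology Int_absorb)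
  let ?Z = "prod_topology (subtopology M (cdom c)) (top_of_set I)"
  have "continuous_map (subtopology M (cdom c)) (top_of_set (cimage c)) (cmap c)"
    using ch by (simp add: is_chart_def homeomorphic_imp_continuous_map)
  then have "continuous_map ?Z (top_of_set (cimage c)) (cmap c \<circ> fst)"
    by (rule continuous_map_compose[OF continuous_map_fst])
  then have "continuous_map ?Z (prod_topology (top_of_set I) (top_of_set (cimage c))) (\<lambda>p. (snd p, (cmap c \<circ> fst) p))"
    by (intro continuous_map_pairedI continuous_map_snd)
  then have "continuous_map ?Z (top_of_set (I \<times> cimage c)) (\<lambda>p. (snd p, (cmap c \<circ> fst) p))"
    by simp
  moreover have "continuous_map (top_of_set (I \<times> cimage c)) euclideanreal (\<lambda>(t, y). E c t y)"
    using loc[OF c] by simp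
  ultimately have "continuous_map ?Z euclideanreal ((\<lambda>(t, y). E c t y) \<circ> (\<lambda>p. (snd p, (cmap c \<circ> fst) p)))"
    by (rule continuous_map_compose)
  then have "continuous_map ?Z euclideanreal (\<lambda>(x, t). F x t)"
    by (rule continuous_map_eq) (auto simp: F[OF c])
  then show "continuous_map (subtopology (prod_topology M (top_of_set I)) (cdom c \<times> I)) euclideanreal (\<lambda>(x, t). F x t)"
    by (simp only: top)
next
  fix p assume "p \<in> topspace (prod_topology M (top_of_set I))"
  then have "fst p \<in> topspace M" "snd p \<in> I" by auto
  moreover have "(\<Union>c\<in>\<A>. cdom c) = topspace M" using at unfolding smooth_atlas_def by blast
  ultimately obtain c where "c \<in> \<A>" "p \<in> cdom c \<times> I" by (metis SigmaI UN_E prod.collapse)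
  then show "\<exists>c. c \<in> \<A> \<and> p \<in> cdom c \<times> I \<and> (case p of (x, t) \<Rightarrow> F x t) = (case p of (x, t) \<Rightarrow> F x t)"
    by blast
qed simp

lemma coord_flow_chart:
  fixes \<A> :: "('a, 'n::finite) chart set"
  assumes at: "smooth_atlas M \<A>" and rf: "ricci_flow \<A> T g" and sol: "classical_solution \<A> T g h l u"
    and h: "continuous_on {0..T} h" "\<forall>t\<in>{0..T}. h t \<le> 0" and l: "1 \<le> l"
    and pos: "\<forall>x\<in>topspace M. \<forall>t\<in>{0..T}. 0 < u x t" and c: "c \<in> \<A>"
  shows "coord_flow (cimage c) T l (\<lambda>t. in_coords c (g t c)) h (\<lambda>t. in_coords c (\<lambda>x. u x t))"
proof
  have ch: "is_chart M c" using at c by (auto simp: smooth_atlas_def)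
  note coords = in_coords_cmap[OF ch]
  have metric: "riemannian_metric \<A> (g t)" if "t \<in> {0..T}" for t
    using rf that by (auto simp: ricci_flow_def)
  have cont_dom: "cdom c \<subseteq> topspace M" using at c by (auto simp: smooth_atlas_def)
  show op: "open (cimage c)" using ch by (simp add: is_chart_def)
  have "smooth_on (\<lambda>(t, y). in_coords c (g t c) y) ({0..T} \<times> cimage c)"
    using rf c by (auto simp: ricci_flow_def)
  then have "C_k_on 2 (\<lambda>(t, y). in_coords c (g t c) y) ({0..T} \<times> cimage c)"
    by (simp only: smooth_on_def)
  from C_k_on_imp_C_k_in_space[OF op bounded_linear_compose[OF bounded_linear_vec_nth bounded_linear_vec_nth] this]
  show "C_k_in_space 2 (\<lambda>t y. in_coords c (g t c) y $ i $ j) {0..T} (cimage c)" for i j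
    by simp
  show "transpose (in_coords c (g t c) y) = in_coords c (g t c) y" if "t \<in> {0..T}" "y \<in> cimage c" for t y
    using metric[OF that(1)] c that by (auto simp: riemannian_metric_def coords)
  show "0 < v \<bullet> (in_coords c (g t c) y *v v)" if "t \<in> {0..T}" "y \<in> cimage c" "v \<noteq> 0" for t y v
    using metric[OF that(1)] c that by (auto simp: riemannian_metric_def coords)
  show "((\<lambda>s. in_coords c (g s c) y) has_vector_derivative (-2) *\<^sub>R ricci_coords (in_coords c (g t c)) y) (at t within {0..T})"
    if "t \<in> {0..T}" "y \<in> cimage c" for t y
    using rf c that by (auto simp: ricci_flow_def coords ricci_def)
  show "C_k_in_space 3 (\<lambda>t. in_coords c (\<lambda>x. u x t)) {0<..T} (cimage c)"
    using sol c by (auto simp: classical_solution_def)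
  show "((\<lambda>s. in_coords c (\<lambda>x. u x s) y) has_real_derivative
      laplacian_coords (in_coords c (g t c)) (in_coords c (\<lambda>x. u x t)) y + h t * in_coords c (\<lambda>x. u x t) y powr (l - 1))
      (at t within {0..T})" if "t \<in> {0..T}" "y \<in> cimage c" for t y
    using sol c that by (auto simp: classical_solution_def coords laplacian_def)
  show "0 < in_coords c (\<lambda>x. u x t) y" if "t \<in> {0..T}" "y \<in> cimage c" for t y
    using pos cont_dom that by (auto simp: coords)
qed (use h l in auto)

section \<open>The gradient estimate\<close>

theorem theorem2p2:
  fixes X :: "'a topology"
    and \<A> :: "('a, 'n::finite) chart set"
    and g :: "real \<Rightarrow> ('a, 'n) metric"
    and T l :: real
    and h :: "real \<Rightarrow> real"
    and u :: "'a \<Rightarrow> real \<Rightarrow> real"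
  assumes "closed_manifold X \<A>"
    and "0 < T"
    and "ricci_flow \<A> T g"
    and "1 \<le> l"
    and "C_k_on 1 h {0..T}"
    and "\<forall>t\<in>{0..T}. h t \<le> 0"
    and "\<forall>x\<in>topspace X. \<forall>t\<in>{0..T}. 0 < u x t"
    and "classical_solution \<A> T g h l u"
  shows "\<forall>c\<in>\<A>. \<forall>x\<in>cdom c. \<forall>t\<in>{0<..T}.
    grad_norm_sq (g t) c (\<lambda>z. u z t) x
      \<le> 1 / (2 * t) * ((SUP z\<in>topspace X. (u z 0)\<^sup>2) - (u x t)\<^sup>2)"
proof -
  let ?G = "\<lambda>c t. in_coords c (g t c)" and ?w = "\<lambda>c t. in_coords c (\<lambda>x. u x t)"
  have at: "smooth_atlas X \<A>" and comp: "compact_space X"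
    using assms(1) by (auto simp: closed_manifold_def)
  have cover: "\<exists>c\<in>\<A>. x \<in> cdom c" if "x \<in> topspace X" for x
    using at that unfolding smooth_atlas_def by blast
  have dom: "cdom c \<subseteq> topspace X" if "c \<in> \<A>" for c
    using at that by (auto simp: smooth_atlas_def)
  have ch: "is_chart X c" if "c \<in> \<A>" for c using at that by (auto simp: smooth_atlas_def)
  note coords = in_coords_cmap[OF ch]
  have "continuous_on {0..T} h"
    using assms(5) by (intro differentiable_imp_continuous_on) (simp add: differentiable_on_def)
  note flow = coord_flow_chart[OF at assms(3) assms(8) this assms(6) assms(4) assms(7)]
  have w2: "C_k_in_space 2 (?w c) {0..T} (cimage c)" if "c \<in> \<A>" for c
    using assms(8) that by (auto simp: classical_solution_def)
  have indep: "grad_norm_sq (g t) c (\<lambda>z. u z t) x = grad_norm_sq (g t) d (\<lambda>z. u z t) x"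
    if "c \<in> \<A>" "d \<in> \<A>" "x \<in> cdom c" "x \<in> cdom d" "t \<in> {0..T}" for c d x t
  proof (rule grad_norm_sq_chart_independent[OF at])
    show "riemannian_metric \<A> (g t)" using assms(3) that by (auto simp: ricci_flow_def)
    show "in_coords d (\<lambda>z. u z t) differentiable at (cmap d x)"
      using C_k_in_space_differentiable[OF w2[OF that(2)]] that by simp
  qed (use that in auto)
  \<comment> \<open>The energy as a function on the manifold: any chart around \<open>x\<close> gives the same value.\<close>
  define F where "F x t = t * grad_norm_sq (g t) (SOME c. c \<in> \<A> \<and> x \<in> cdom c) (\<lambda>z. u z t) x + (u x t)\<^sup>2 / 2" for x t
  have F: "F x t = t * grad_norm_sq (g t) c (\<lambda>z. u z t) x + (u x t)\<^sup>2 / 2"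
    if "c \<in> \<A>" "x \<in> cdom c" "t \<in> {0..T}" for c x t
  proof -
    let ?d = "SOME c. c \<in> \<A> \<and> x \<in> cdom c"
    have "?d \<in> \<A> \<and> x \<in> cdom ?d" by (rule someI[of _ c]) (use that in auto)
    then show ?thesis using indep[of ?d c x t] that by (simp add: F_def)
  qed
  define E where "E c t y = t * (gradient_coords (?G c t) (?w c t) y
      \<bullet> (?G c t y *v gradient_coords (?G c t) (?w c t) y)) + (?w c t y)\<^sup>2 / 2" for c t y
  have F_coords: "F x t = E c t (cmap c x)" if "c \<in> \<A>" "x \<in> cdom c" "t \<in> {0..T}" for c x t
    using that by (simp add: E_def F grad_norm_sq_def coords Let_def)
  have F_cont: "continuous_map (prod_topology X (top_of_set {0..T})) euclideanreal (\<lambda>(x, t). F x t)"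
  proof (rule continuous_map_chartwise[where E = E and F = F, OF at _ F_coords])
    fix c assume c: "c \<in> \<A>"
    interpret coord_flow "cimage c" T l "?G c" h "?w c" by (rule flow[OF c])
    have "C_k_in_space 0 (\<lambda>t y. gradient_coords (?G c t) (?w c t) y
        \<bullet> (?G c t y *v gradient_coords (?G c t) (?w c t) y)) {0..T} (cimage c)"
      by (rule C_k_in_space_grad_norm[OF open_V C_k_in_space_le[OF smooth_G] invertible_flow C_k_in_space_le[OF w2[OF c]]]) auto
    then show "continuous_on ({0..T} \<times> cimage c) (\<lambda>(t, y). E c t y)"
      using C_k_in_space_cont[OF w2[OF c]]
      by (auto simp: E_def case_prod_unfold intro!: continuous_intros)
  qed
  have compact_F: "compactin (prod_topology X (top_of_set {0..T})) (topspace X \<times> {0..T})"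
  proof -
    have "compact_space (prod_topology X (top_of_set {0..T}))"
      using comp by (simp add: compact_space_prod_topology compact_space_subtopology)
    then show ?thesis by (simp add: compact_space_def)
  qed
  have attains: "\<exists>p\<in>topspace X \<times> {0..T}. \<forall>q\<in>topspace X \<times> {0..T}. \<Phi> q \<le> \<Phi> p"
    if "continuous_map (prod_topology X (top_of_set {0..T})) euclideanreal \<Phi>" "topspace X \<noteq> {}" for \<Phi>
  proof -
    have "compact (\<Phi> ` (topspace X \<times> {0..T}))"
      using image_compactin[OF compact_F that(1)] by simp
    moreover have "\<Phi> ` (topspace X \<times> {0..T}) \<noteq> {}" using that(2) assms(2) by auto
    ultimately show ?thesis using compact_attains_sup[of "\<Phi> ` (topspace X \<times> {0..T})"] by auto
  qed
  define A where "A = (SUP z\<in>topspace X. (u z 0)\<^sup>2)"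
  have F0: "F z 0 = (u z 0)\<^sup>2 / 2" for z by (simp add: F_def)
  have init: "(u z 0)\<^sup>2 \<le> A" if z: "z \<in> topspace X" for z
  proof -
    obtain p where p: "\<And>q. q \<in> topspace X \<times> {0..T} \<Longrightarrow> (\<lambda>(x, t). F x t) q \<le> (\<lambda>(x, t). F x t) p"
      using attains[OF F_cont] z by blast
    have "(u z 0)\<^sup>2 \<le> 2 * (\<lambda>(x, t). F x t) p" if "z \<in> topspace X" for z
      using p[of "(z, 0)"] that assms(2) F0[of z] by simp
    then have "bdd_above ((\<lambda>z. (u z 0)\<^sup>2) ` topspace X)" by (intro bdd_aboveI2)
    then show ?thesis unfolding A_def by (rule cSUP_upper[OF z])
  qed
  have key: "F x t \<le> A / 2" if x: "x \<in> topspace X" and t: "t \<in> {0<..T}" for x t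
  proof (rule ccontr)
    assume neg: "\<not> F x t \<le> A / 2"
    \<comment> \<open>Subtracting \<open>\<epsilon> t\<close> makes the differential inequality strict; \<open>\<epsilon>\<close> is half the slope that would lower
      the value at \<open>(x, t)\<close> to \<open>A / 2\<close>, so the maximum is still not attained at time \<open>0\<close>.\<close>
    define \<epsilon> where "\<epsilon> = (F x t - A / 2) / (2 * t)"
    have \<epsilon>: "\<epsilon> > 0" "F x t - \<epsilon> * t > A / 2" using neg t by (auto simp: \<epsilon>_def field_simps)
    have "continuous_map (prod_topology X (top_of_set {0..T})) euclideanreal (\<lambda>p. (\<lambda>(x, t). F x t) p - \<epsilon> * snd p)"
      by (intro continuous_map_diff F_cont continuous_map_real_mult_left
          continuous_map_into_fulltopology[OF continuous_map_snd])
    then obtain p where p: "p \<in> topspace X \<times> {0..T}"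
      "\<forall>q\<in>topspace X \<times> {0..T}. (\<lambda>(x, t). F x t) q - \<epsilon> * snd q \<le> (\<lambda>(x, t). F x t) p - \<epsilon> * snd p"
      using attains x by blast
    define x1 where "x1 = fst p"
    define t1 where "t1 = snd p"
    have p_eq: "p = (x1, t1)" by (simp add: x1_def t1_def)
    have m: "x1 \<in> topspace X" "t1 \<in> {0..T}" using p(1) by (auto simp: p_eq)
    have m_max: "F z s - \<epsilon> * s \<le> F x1 t1 - \<epsilon> * t1" if "z \<in> topspace X" "s \<in> {0..T}" for z s
      using bspec[OF p(2), of "(z, s)"] that by (simp add: p_eq)
    have "t1 \<noteq> 0"
    proof
      assume "t1 = 0"
      then have "F x t - \<epsilon> * t \<le> (u x1 0)\<^sup>2 / 2" using m_max[OF x, of t] t F0 by simp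
      then show False using \<epsilon> init[OF m(1)] by simp
    qed
    then have t1: "t1 \<in> {0<..T}" using m(2) by auto
    obtain c where c: "c \<in> \<A>" "x1 \<in> cdom c" using cover m(1) by blast
    interpret coord_flow "cimage c" T l "?G c" h "?w c" by (rule flow[OF c(1)])
    interpret s: coord_metric "cimage c" "?G c t1" by (rule coord_metric_at[OF m(2)])
    let ?y = "cmap c x1"
    have y: "?y \<in> cimage c" using c by blast
    have energy_F: "energy s (cmap c z) = F z s" if "z \<in> cdom c" "s \<in> {0..T}" for z s
    proof (cases "s = 0")
      \<comment> \<open>The gradient term carries the factor \<open>s\<close>, so its value at time \<open>0\<close> is immaterial.\<close>
      case True
      then show ?thesis using F0[of z] by (simp add: coords[OF c(1) that(1)])
    next
      case False
      then have "s \<in> {0<..T}" using that by auto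
      then show ?thesis
        using coord_function.grad_sq_eq[OF coord_function_at, of s "cmap c z"] F_coords[OF c(1) that] that(1) by (simp add: E_def)
    qed
    obtain D where D: "((\<lambda>s. energy s ?y) has_real_derivative D) (at t1 within {0..T})"
      "D \<le> laplacian_coords (?G c t1) (energy t1) ?y"
      using energy_subsolution[OF t1 y] by blast
    \<comment> \<open>At the maximum of \<open>F - \<epsilon> t\<close> the space derivatives give \<open>\<Delta>F \<le> 0\<close> and the time derivative gives
      \<open>\<partial>\<^sub>t F \<ge> \<epsilon>\<close>, against \<open>\<partial>\<^sub>t F \<le> \<Delta>F\<close>.\<close>
    have "laplacian_coords (?G c t1) (energy t1) ?y \<le> 0"
    proof (rule s.laplacian_nonpos_at_max[OF y C_k_energy[OF t1]])
      fix z assume "z \<in> cimage c"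
      then obtain z' where z': "z = cmap c z'" "z' \<in> cdom c" by blast
      then show "energy t1 z \<le> energy t1 ?y"
        using m_max[of z' t1] m(2) dom[OF c(1)] energy_F[OF z'(2) m(2)] energy_F[OF c(2) m(2)] by auto
    qed
    moreover have "0 \<le> D - \<epsilon>"
    proof (rule DERIV_nonneg_at_max_over_past)
      show "((\<lambda>s. energy s ?y - \<epsilon> * s) has_real_derivative D - \<epsilon>) (at t1 within {0..T})"
        by (rule DERIV_diff[OF D(1) DERIV_cmult_Id])
      show "energy s ?y - \<epsilon> * s \<le> energy t1 ?y - \<epsilon> * t1" if "s \<in> {0..t1}" for s
      proof -
        have s: "s \<in> {0..T}" using that m(2) by auto
        show ?thesis using m_max[OF m(1) s] energy_F[OF c(2) s] energy_F[OF c(2) m(2)] by simp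
      qed
    qed (use t1 in auto)
    ultimately show False using D(2) \<epsilon>(1) by linarith
  qed
  show ?thesis
  proof (intro ballI)
    fix c x t assume c: "c \<in> \<A>" "x \<in> cdom c" and t: "t \<in> {0<..T}"
    have "F x t \<le> A / 2" using key dom c t by blast
    then have "t * grad_norm_sq (g t) c (\<lambda>z. u z t) x + (u x t)\<^sup>2 / 2 \<le> A / 2"
      using F[OF c, of t] t by simp
    then show "grad_norm_sq (g t) c (\<lambda>z. u z t) x
      \<le> 1 / (2 * t) * ((SUP z\<in>topspace X. (u z 0)\<^sup>2) - (u x t)\<^sup>2)"
      using t by (simp add: A_def[symmetric] field_simps)
  qed
qed

end
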